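(* There exist absolute constants $c_1,c_2>0$ such that for every prime $p$ and every positive integer $k$, with $n=p^k$, \[c_1\, p^{\frac{k-\lfloor k/3\rfloor}{2}}\le \operatorname{disc}(\mathcal A_n)\le c_2\, p^{\frac{k-\lfloor k/3\rfloor}{2}};\] equivalently $\operatorname{disc}(\mathcal A_n)=\Theta\big(n^{\frac13+\frac{r_k}{6k}}\big)$, where $r_k\in\{0,1,2\}$ is the remainder of $k$ modulo $3$.
   Context: For a positive integer $n$, an arithmetic progression in $\mathbb{Z}_n$ is a set $\{a+kd: 0\le k<l\}$ with $a,d\in\mathbb{Z}_n$ and $l$ an integer with $0\le l\le n/\gcd(n,d)$ (here $\gcd(d,n)$ is computed for any integer representative of $d$, so $\gcd(0,n)=n$). $\mathcal A_n$ denotes the family of all arithmetic progressions in $\mathbb{Z}_n$. For $\chi:\mathbb{Z}_n\to\{1,-1\}$ and $A\subseteq\mathbb{Z}_n$, $\chi(A)=\sum_{x\in A}\chi(x)$, and $\operatorname{disc}(\mathcal A_n)=\min_{\chi:\mathbb{Z}_n\to\{1,-1\}}\max_{A\in\mathcal A_n}|\chi(A)|$. *)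

theory Defs
  imports "HOL-Analysis.Analysis" "HOL-Library.FuncSet"
begin

definition ap_Zn :: "nat \<Rightarrow> nat \<Rightarrow> nat \<Rightarrow> nat \<Rightarrow> nat set" where
  "ap_Zn n a d l = {(a + k * d) mod n | k. k < l}"

definition APs :: "nat \<Rightarrow> nat set set" where
  "APs n = {ap_Zn n a d l | a d l. a < n \<and> d < n \<and> l \<le> n div gcd n d}"

definition colourings :: "nat \<Rightarrow> (nat \<Rightarrow> int) set" where
  "colourings n = ({0..<n} \<rightarrow>\<^sub>E {1, -1})"

definition max_disc :: "nat \<Rightarrow> (nat \<Rightarrow> int) \<Rightarrow> int" where
  "max_disc n f = Max ((\<lambda>A. \<bar>\<Sum>x\<in>A. f x\<bar>) ` APs n)"

definition disc_AP :: "nat \<Rightarrow> int" where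
  "disc_AP n = Min (max_disc n ` colourings n)"

end

theory Submission
  imports Defs
begin

text \<open>
Write s = k div 3 and N = p^(k-s); both bounds are of order sqrt N.

Lower bound, by Fourier analysis on Z_n. Averaged over all differences prime to p, the progressions
of length about N/2 have squared Fourier coefficients of order N at every frequency not divisible
by p^(s+1), while the cosets of size p^(s+1) have squared coefficients p^(2s+2) \<ge> N at the
remaining frequencies. By Parseval one of these progressions has discrepancy of order sqrt N.

Upper bound. Take a colouring of period N. A progression then runs at most p^s \<le> sqrt N times through
a coset in Z_N and then along an incomplete progression in Z_N. Listing Z_N in digit-reversed order
makes every coset an interval; giving opposite colours to consecutive elements of that list
bounds every coset sum by 2. One free sign per pair remains, and every incomplete progression is an
interval in one of N orderings of Z_N. Beck's partial colouring method, applied to dyadic blocks of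
these orderings, chooses the signs such that all initial segments have discrepancy O(sqrt N).
\<close>

section \<open>Partial colouring\<close>

text \<open>Origin of \<open>s\<close>: p^s laps through a coset are affordable only if p^(2s) \<le>
  p^(k-s), that is 3s \<le> k; cosets of size p^(s+1) are strong enough for the lower bound only if
  p^(2s+2) \<ge> p^(k-s), that is k \<le> 3s+2. The quotient \<open>k div 3\<close> is the one value
  meeting both. The obstacle above is that the error on a coset is multiplied by the number of laps,
  so coset sums must be O(1), far below what partial colouring delivers. They are therefore settled
  by the pairing, before any sign is chosen. Each ordering of Z_N then induces two orderings of the
  pairs, by their first and by their second members. Independent random signs with a union bound
  would lose a logarithmic factor; entropy counting avoids it, since the deviation allowed at each
  dyadic level is tuned to the number of blocks there. The obstacle below is that the Fourier
  transform of a single long progression may be small at most frequencies; only the average over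
  differences is uniformly large.\<close>

lemma cosh_le_exp_half_square: "cosh x \<le> exp (x\<^sup>2 / 2)" for x :: real
proof -
  have a: "(\<lambda>n. if even n then x ^ n /\<^sub>R fact n else 0) sums cosh x" by (rule cosh_converges)
  have "(if even n then x ^ n /\<^sub>R fact n else 0) = 0" if "n \<notin> range (\<lambda>n. 2 * n)" for n
    using that by (auto elim!: evenE)
  with a have c: "(\<lambda>n. x ^ (2*n) /\<^sub>R fact (2*n)) sums cosh x"
    using sums_mono_reindex[of "\<lambda>n::nat. 2*n" "\<lambda>n. if even n then x ^ n /\<^sub>R fact n else 0" "cosh x"]
    by (simp add: strict_mono_def)
  have e: "(\<lambda>n. (x\<^sup>2/2) ^ n /\<^sub>R fact n) sums exp (x\<^sup>2/2)" by (rule exp_converges)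
  \<comment> \<open>Termwise comparison of two power series: the coefficient of
    \<open>x ^ (2*n)\<close> is 1 / (2n)! in cosh and 1 / (2^n n!) in exp(x^2/2).\<close>
  have f: "2 ^ n * fact n \<le> (fact (2*n) :: real)" for n
  proof (induction n)
    case (Suc n)
    have "2 ^ Suc n * fact (Suc n) = (2 * (real n + 1)) * (2 ^ n * fact n :: real)" by (simp add: algebra_simps)
    also have "\<dots> \<le> (2 * (real n + 1) * (2 * real n + 1)) * fact (2*n)"
      by (intro mult_mono Suc) (auto simp: algebra_simps)
    also have "\<dots> = fact (2 * Suc n)" by (simp add: algebra_simps)
    finally show ?case .
  qed simp
  show ?thesis
  proof (rule sums_le[OF _ c e])
    fix n
    have "x ^ (2*n) / fact (2*n) \<le> x ^ (2*n) / (2 ^ n * fact n)"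
      by (rule divide_left_mono[OF f]) (auto simp: power_mult)
    moreover have "(x\<^sup>2/2) ^ n = x ^ (2*n) / 2 ^ n" by (simp add: power_divide power_mult)
    ultimately show "x ^ (2*n) /\<^sub>R fact (2*n) \<le> (x\<^sup>2/2) ^ n /\<^sub>R fact n"
      by (simp add: field_simps)
  qed
qed

text \<open>Averages over this set play the part of independent random signs. Extensionality makes
  the set finite, with one element per choice of signs.\<close>

definition signings :: "'a set \<Rightarrow> ('a \<Rightarrow> real) set" where
  "signings Y = (Y \<rightarrow>\<^sub>E {1, -1})"

lemma finite_signings [simp]: "finite Y \<Longrightarrow> finite (signings Y)"
  by (simp add: signings_def finite_PiE)

lemma card_signings: "finite Y \<Longrightarrow> card (signings Y) = 2 ^ card Y"
  by (simp add: signings_def card_PiE numeral_2_eq_2)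

lemma signings_mem: "\<epsilon> \<in> signings Y \<Longrightarrow> y \<in> Y \<Longrightarrow> \<epsilon> y = 1 \<or> \<epsilon> y = -1"
  by (auto simp: signings_def PiE_def Pi_def)

text \<open>Independence of the signs: the average of a product is the product of the averages, here
  without normalisation.\<close>

lemma sum_signings_prod:
  assumes "finite Y"
  shows "(\<Sum>\<epsilon>\<in>signings Y. \<Prod>y\<in>Y. h y (\<epsilon> y)) = (\<Prod>y\<in>Y. h y 1 + h y (-1) :: real)"
  unfolding signings_def using prod_sum_PiE[of Y "\<lambda>_. {1,-1::real}" h] assms by simp

lemma sum_signings_exp:
  assumes "finite Y" "S \<subseteq> Y"
  shows "(\<Sum>\<epsilon>\<in>signings Y. exp (t * (\<Sum>y\<in>S. \<epsilon> y))) = 2 ^ card Y * cosh t ^ card S"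
proof -
  have fS: "finite S" using assms finite_subset by blast
  have "(\<Sum>\<epsilon>\<in>signings Y. exp (t * (\<Sum>y\<in>S. \<epsilon> y))) = (\<Sum>\<epsilon>\<in>signings Y. \<Prod>y\<in>Y. if y \<in> S then exp (t * \<epsilon> y) else 1)"
    using assms fS by (intro sum.cong refl) (simp add: sum_distrib_left exp_sum prod.If_cases Int_absorb1)
  also have "\<dots> = (\<Prod>y\<in>Y. (if y \<in> S then exp t else 1) + (if y \<in> S then exp (-t) else 1))"
    using sum_signings_prod[OF assms(1), of "\<lambda>y z. if y \<in> S then exp (t * z) else 1"] by (simp cong: if_cong)
  also have "\<dots> = (\<Prod>y\<in>Y. 2 * (if y \<in> S then cosh t else 1))"
    by (intro prod.cong) (auto simp: cosh_field_def)
  also have "\<dots> = 2 ^ card Y * cosh t ^ card S"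
    using assms fS by (simp only: prod.distrib) (simp add: prod.If_cases Int_absorb1)
  finally show ?thesis .
qed

text \<open>A nonzero rounded value forces |w| \<ge> 1, and |w| never exceeds exp(|w| - 1). This
  trades rounded sums for exponential moments, which factor over the signs.\<close>

lemma abs_round_le_exp:
  fixes w \<mu> :: real
  assumes "\<mu> \<ge> 1"
  shows "of_int \<bar>round (w / 2)\<bar> \<le> exp (- \<mu>) * (exp (\<mu> * w) + exp (- \<mu> * w))"
proof (cases "round (w/2) = 0")
  case False
  have r: "\<bar>of_int (round (w/2)) - w/2\<bar> \<le> 1/2" by (rule of_int_round_abs_le)
  have one: "1 \<le> \<bar>real_of_int (round (w/2))\<bar>" using False by linarith
  have w1: "\<bar>w\<bar> \<ge> 1" using r one by linarith
  have "of_int \<bar>round (w / 2)\<bar> \<le> \<bar>w\<bar>" using r w1 by (simp add: abs_if split: if_splits)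
  also have "\<dots> \<le> exp (\<bar>w\<bar> - 1)" using exp_ge_add_one_self[of "\<bar>w\<bar> - 1"] by simp
  also have "\<dots> \<le> exp (\<mu> * (\<bar>w\<bar> - 1))" using assms w1 mult_right_mono[of 1 \<mu> "\<bar>w\<bar> - 1"] by simp
  also have "\<dots> = exp (-\<mu>) * exp (\<mu> * \<bar>w\<bar>)" by (simp add: algebra_simps flip: exp_add)
  also have "\<dots> \<le> exp (-\<mu>) * (exp (\<mu> * w) + exp (- \<mu> * w))"
    by (intro mult_left_mono) (auto simp: abs_if)
  finally show ?thesis .
qed (simp add: add_nonneg_nonneg)

text \<open>A Chernoff bound. The bins have width 2\<Delta> with \<Delta> =
  \<open>sqrt (L * s)\<close>, about sqrt L standard deviations to either side. The exponent
  L/\<Delta> keeps the moment below exp(L/2), against the factor exp(-L) from the rounding.\<close>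

lemma sum_signings_round_le:
  assumes "finite Y" "S \<subseteq> Y" "real (card S) \<le> s" "s > 0" "L \<ge> 1"
  shows "(\<Sum>\<epsilon>\<in>signings Y. of_int \<bar>round ((\<Sum>y\<in>S. \<epsilon> y) / (2 * sqrt (L * s)))\<bar>)
           \<le> real (card (signings Y)) * (2 * exp (- L / 2))"
proof -
  define \<Delta> where "\<Delta> = sqrt (L * s)"
  have D: "\<Delta> > 0" "\<Delta>\<^sup>2 = L * s" using assms by (auto simp: \<Delta>_def)
  have ch: "cosh (L/\<Delta>) ^ card S \<le> exp (L/2)"
  proof -
    have "cosh (L/\<Delta>) ^ card S \<le> exp ((L/\<Delta>)\<^sup>2/2) ^ card S"
      by (intro power_mono cosh_le_exp_half_square) (simp add: cosh_real_nonneg)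
    also have "\<dots> = exp (card S * ((L/\<Delta>)\<^sup>2/2))" by (simp only: exp_of_nat_mult)
    also have "card S * ((L/\<Delta>)\<^sup>2/2) \<le> s * ((L/\<Delta>)\<^sup>2/2)" using assms by (intro mult_right_mono) auto
    also have "s * ((L/\<Delta>)\<^sup>2/2) = L/2" using assms D by (simp add: power_divide power2_eq_square)
    finally show ?thesis by simp
  qed
  have "(\<Sum>\<epsilon>\<in>signings Y. of_int \<bar>round ((\<Sum>y\<in>S. \<epsilon> y) / (2 * \<Delta>))\<bar>)
     \<le> (\<Sum>\<epsilon>\<in>signings Y. exp (-L) * (exp (L/\<Delta> * (\<Sum>y\<in>S. \<epsilon> y)) + exp (- L/\<Delta> * (\<Sum>y\<in>S. \<epsilon> y))))"
  proof (rule sum_mono)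
    fix \<epsilon> :: "'a \<Rightarrow> real"
    show "of_int \<bar>round ((\<Sum>y\<in>S. \<epsilon> y) / (2 * \<Delta>))\<bar> \<le> exp (-L) * (exp (L/\<Delta> * (\<Sum>y\<in>S. \<epsilon> y)) + exp (- L/\<Delta> * (\<Sum>y\<in>S. \<epsilon> y)))"
      using abs_round_le_exp[OF assms(5), of "(\<Sum>y\<in>S. \<epsilon> y) / \<Delta>"] by (simp add: mult.commute)
  qed
  also have "\<dots> = exp (-L) * (2 ^ card Y * cosh (L/\<Delta>) ^ card S + 2 ^ card Y * cosh (- L/\<Delta>) ^ card S)"
    using assms(1,2) by (simp only: sum.distrib sum_signings_exp flip: sum_distrib_left)
  also have "\<dots> = 2 ^ card Y * (2 * (exp (-L) * cosh (L/\<Delta>) ^ card S))" by (simp add: algebra_simps)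
  also have "\<dots> \<le> 2 ^ card Y * (2 * (exp (-L) * exp (L/2)))"
    by (intro mult_left_mono ch) auto
  also have "exp (-L) * exp (L/2) = exp (-L/2)" by (simp flip: exp_add)
  finally show ?thesis using assms(1) by (simp add: card_signings \<Delta>_def)
qed

lemma sum_exp_abs_int_le:
  fixes \<kappa> :: real
  assumes "\<kappa> \<ge> 1"
  shows "(\<Sum>z\<in>{- int M..int M}. exp (- \<kappa> * of_int \<bar>z\<bar>)) \<le> 1 + 4 * exp (- \<kappa>)"
proof -
  define q where "q = exp (-\<kappa>)"
  have q: "0 < q" "q \<le> 1/2"
  proof -
    have "2 \<le> exp \<kappa>" using exp_ge_add_one_self[of \<kappa>] assms by linarith
    thus "q \<le> 1/2" by (simp add: q_def exp_minus field_simps)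
  qed (simp add: q_def)
  have ex: "exp (- \<kappa> * of_int \<bar>z\<bar>) = q ^ nat \<bar>z\<bar>" for z
    unfolding q_def by (simp flip: exp_of_nat_mult add: mult.commute)
  \<comment> \<open>Strengthened for the induction: the extra term bounds the missing tail, and
    since q \<le> 1/2 it drops at each step by at least the two new terms.\<close>
  have "(\<Sum>z\<in>{- int M..int M}. q ^ nat \<bar>z\<bar>) + 4 * q * q ^ M \<le> 1 + 4 * q"
  proof (induction M)
    case (Suc M)
    have "{- int (Suc M)..int (Suc M)} = insert (- int (Suc M)) (insert (int (Suc M)) {- int M..int M})" by auto
    hence "(\<Sum>z\<in>{- int (Suc M)..int (Suc M)}. q ^ nat \<bar>z\<bar>) = 2 * q * q ^ M + (\<Sum>z\<in>{- int M..int M}. q ^ nat \<bar>z\<bar>)"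
      by (simp add: nat_add_distrib)
    moreover have "4 * q * q ^ Suc M \<le> 2 * q * q ^ M"
      using q by (simp add: mult_le_cancel_right1)
    ultimately show ?case using Suc by simp
  qed simp
  moreover have "4 * q * q ^ M \<ge> 0" using q by simp
  moreover have "(\<Sum>z\<in>{- int M..int M}. exp (- \<kappa> * of_int \<bar>z\<bar>)) = (\<Sum>z\<in>{- int M..int M}. q ^ nat \<bar>z\<bar>)"
    by (intro sum.cong refl ex)
  ultimately show ?thesis unfolding q_def[symmetric] by linarith
qed

text \<open>A fibre of the map b is large because its image carries little weight: a value v has weight
  exp (- sum of L i / 2 * |v i|), the total weight of all integer vectors is close to 1, and by
  Jensen's inequality the average weight over E is not small.\<close>

lemma ex_large_fibre:
  fixes b :: "'i \<Rightarrow> 'e \<Rightarrow> int" and L :: "'i \<Rightarrow> real"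
  assumes I: "finite I" and E: "finite E" "E \<noteq> {}"
    and L: "\<And>i. i \<in> I \<Longrightarrow> L i \<ge> 2"
    and avg: "\<And>i. i \<in> I \<Longrightarrow> (\<Sum>e\<in>E. of_int \<bar>b i e\<bar>) \<le> real (card E) * (2 * exp (- L i / 2))"
    and cost: "(\<Sum>i\<in>I. (L i + 4) * exp (- L i / 2)) \<le> A"
  shows "\<exists>v. real (card E) * exp (- A) \<le> real (card {e\<in>E. \<forall>i\<in>I. b i e = v i})"
proof -
  define X where "X e = (\<Sum>i\<in>I. L i / 2 * of_int \<bar>b i e\<bar>)" for e
  define a where "a = (\<Sum>i\<in>I. L i * exp (- L i / 2))"
  define g where "g e = restrict (\<lambda>i. b i e) I" for e
  define fib where "fib v = {e\<in>E. g e = v}" for v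
  define F where "F = Max ((\<lambda>v. card (fib v)) ` g ` E)"
  have finV: "finite (g ` E)" using E by simp
  have sumX: "(\<Sum>e\<in>E. X e) \<le> real (card E) * a"
  proof -
    have "(\<Sum>e\<in>E. X e) = (\<Sum>i\<in>I. L i / 2 * (\<Sum>e\<in>E. of_int \<bar>b i e\<bar>))"
      unfolding X_def by (subst sum.swap) (simp only: sum_distrib_left)
    also have "\<dots> \<le> (\<Sum>i\<in>I. L i / 2 * (real (card E) * (2 * exp (- L i / 2))))"
    proof (intro sum_mono mult_left_mono avg)
      fix i assume "i \<in> I" thus "0 \<le> L i / 2" using L[of i] by linarith
    qed
    also have "\<dots> = real (card E) * a" by (simp add: a_def sum_distrib_left mult_ac)
    finally show ?thesis .
  qed
  have jensen: "real (card E) * exp (- a) \<le> (\<Sum>e\<in>E. exp (- X e))"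
  proof -
    \<comment> \<open>The tangent of exp(-x) at x = a, where \<open>a\<close> bounds the mean of
      \<open>X\<close>; averaging it over \<open>E\<close> is Jensen's inequality.\<close>
    have pt: "exp (-a) * (1 + a - x) \<le> exp (- x)" for x
      using mult_left_mono[OF exp_ge_add_one_self[of "a - x"], of "exp (-a)"]
      by (simp add: add_diff_eq flip: exp_add)
    have "real (card E) * exp (-a) \<le> exp (-a) * (real (card E) * (1 + a) - (\<Sum>e\<in>E. X e))"
      using sumX by (simp add: algebra_simps)
    also have "\<dots> = (\<Sum>e\<in>E. exp (-a) * (1 + a - X e))"
      by (simp add: sum_subtractf flip: sum_distrib_left)
    also have "\<dots> \<le> (\<Sum>e\<in>E. exp (- X e))" by (intro sum_mono pt)
    finally show ?thesis .
  qed
  \<comment> \<open>All values lie in one finite box, so the total weight expands into a product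
    over i of sums over {-M..M}; the bound on each factor is independent of M.\<close>
  obtain M :: nat where M: "\<And>i e. i \<in> I \<Longrightarrow> e \<in> E \<Longrightarrow> \<bar>b i e\<bar> \<le> int M"
  proof -
    define B where "B = (\<Sum>(i,e)\<in>I\<times>E. \<bar>b i e\<bar>)"
    have "\<bar>b i e\<bar> \<le> B" if "i \<in> I" "e \<in> E" for i e
      unfolding B_def using I E that member_le_sum[of "(i,e)" "I\<times>E" "\<lambda>(i,e). \<bar>b i e\<bar>"] by auto
    moreover have "B \<ge> 0" unfolding B_def by (auto intro: sum_nonneg)
    ultimately show ?thesis using that[of "nat B"] by auto
  qed
  have "(\<Sum>e\<in>E. exp (- X e)) = (\<Sum>v\<in>g ` E. \<Sum>e\<in>fib v. exp (- X e))"
    unfolding fib_def by (rule sum.image_gen[OF E(1)])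
  also have "\<dots> \<le> (\<Sum>v\<in>g ` E. real F * (\<Prod>i\<in>I. exp (- (L i/2) * of_int \<bar>v i\<bar>)))"
  proof (rule sum_mono)
    fix v assume v: "v \<in> g ` E"
    have "exp (- X e) = (\<Prod>i\<in>I. exp (- (L i/2) * of_int \<bar>v i\<bar>))" if "e \<in> fib v" for e
    proof -
      have "v i = b i e" if "i \<in> I" for i using \<open>e \<in> fib v\<close> that by (auto simp: fib_def g_def)
      thus ?thesis using I by (simp add: X_def exp_sum flip: sum_negf)
    qed
    hence "(\<Sum>e\<in>fib v. exp (- X e)) = real (card (fib v)) * (\<Prod>i\<in>I. exp (- (L i/2) * of_int \<bar>v i\<bar>))"
      by simp
    also have "\<dots> \<le> real F * (\<Prod>i\<in>I. exp (- (L i/2) * of_int \<bar>v i\<bar>))"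
      using v finV unfolding F_def by (intro mult_right_mono prod_nonneg) auto
    finally show "(\<Sum>e\<in>fib v. exp (- X e)) \<le> real F * (\<Prod>i\<in>I. exp (- (L i/2) * of_int \<bar>v i\<bar>))" .
  qed
  also have "\<dots> = real F * (\<Sum>v\<in>g ` E. \<Prod>i\<in>I. exp (- (L i/2) * of_int \<bar>v i\<bar>))"
    by (simp add: sum_distrib_left)
  also have "\<dots> \<le> real F * (\<Sum>v\<in>PiE I (\<lambda>_. {- int M..int M}). \<Prod>i\<in>I. exp (- (L i/2) * of_int \<bar>v i\<bar>))"
  proof (intro mult_left_mono sum_mono2)
    show "g ` E \<subseteq> PiE I (\<lambda>_. {- int M..int M})"
      using M by (force simp: g_def abs_le_iff)
  qed (use I in \<open>auto intro!: prod_nonneg finite_PiE\<close>)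
  also have "\<dots> = real F * (\<Prod>i\<in>I. \<Sum>z\<in>{- int M..int M}. exp (- (L i/2) * of_int \<bar>z\<bar>))"
    using I by (subst prod_sum_PiE) auto
  also have "\<dots> \<le> real F * (\<Prod>i\<in>I. exp (4 * exp (- (L i/2))))"
  proof (intro mult_left_mono prod_mono conjI)
    fix i assume "i \<in> I"
    hence "L i / 2 \<ge> 1" using L[of i] by linarith
    from sum_exp_abs_int_le[OF this, of M]
    show "(\<Sum>z\<in>{- int M..int M}. exp (- (L i/2) * of_int \<bar>z\<bar>)) \<le> exp (4 * exp (- (L i/2)))"
      using exp_ge_add_one_self[of "4 * exp (- (L i/2))"] by linarith
  qed (auto intro: sum_nonneg)
  also have "\<dots> = real F * exp (\<Sum>i\<in>I. 4 * exp (- L i/2))" using I by (simp add: exp_sum)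
  finally have "real (card E) * exp (- a) \<le> real F * exp (\<Sum>i\<in>I. 4 * exp (- L i/2))"
    using jensen by linarith
  hence "real (card E) * exp (- a) * exp (- (\<Sum>i\<in>I. 4 * exp (- L i/2))) \<le> real F"
    by (simp add: exp_minus field_simps)
  hence "real (card E) * exp (- (a + (\<Sum>i\<in>I. 4 * exp (- L i/2)))) \<le> real F"
    by (simp add: mult.assoc flip: exp_add)
  \<comment> \<open>The two losses add up to \<open>cost\<close>: \<open>L i\<close> times the
    exponential comes from Jensen's inequality, 4 times it from the total weight.\<close>
  moreover have "exp (- A) \<le> exp (- (a + (\<Sum>i\<in>I. 4 * exp (- L i/2))))"
    using cost by (simp add: a_def distrib_right sum.distrib)
  ultimately have F: "real (card E) * exp (- A) \<le> real F"
    by (smt (verit) mult_left_mono of_nat_0_le_iff)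
  have "F \<in> (\<lambda>v. card (fib v)) ` g ` E" unfolding F_def using E by (intro Max_in) auto
  then obtain v where v: "F = card (fib v)" "v \<in> g ` E" by auto
  have "fib v \<subseteq> {e\<in>E. \<forall>i\<in>I. b i e = v i}" by (auto simp: fib_def g_def)
  hence "F \<le> card {e\<in>E. \<forall>i\<in>I. b i e = v i}" using v E by (auto intro: card_mono)
  with F show ?thesis by (intro exI[of _ v]) linarith
qed

text \<open>Markov's inequality for the weight (1/4)^dist: its total is (5/4)^m, while each point of
  the ball has weight at least 4^(-m/8) = \<beta>^(-m). The bound is the density exp(-m/4) that a
  cost of |Y|/4 guarantees for some fibre of the rounded sums.\<close>

lemma card_hamming_ball_less:
  assumes Y: "finite Y" "Y \<noteq> {}" and e0: "\<epsilon>\<^sub>0 \<in> signings Y"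
  shows "real (card {\<epsilon>\<in>signings Y. 8 * card {y\<in>Y. \<epsilon> y \<noteq> \<epsilon>\<^sub>0 y} \<le> card Y}) < 2 ^ card Y * exp (- real (card Y) / 4)"
proof -
  define m where "m = card Y"
  have m: "m > 0" using Y by (auto simp: m_def card_gt_0_iff)
  define \<beta> :: real where "\<beta> = 2 powr (1/4)"
  define dist where "dist \<epsilon> = card {y\<in>Y. \<epsilon> y \<noteq> \<epsilon>\<^sub>0 y}" for \<epsilon>
  define B where "B = {\<epsilon>\<in>signings Y. 8 * dist \<epsilon> \<le> m}"
  have b0: "\<beta> > 0" by (simp add: \<beta>_def)
  have b4: "\<beta> ^ 4 = 2" by (simp add: \<beta>_def powr_power)
  have "(\<Sum>\<epsilon>\<in>signings Y. (1/4) ^ dist \<epsilon>) = (\<Sum>\<epsilon>\<in>signings Y. \<Prod>y\<in>Y. if \<epsilon> y \<noteq> \<epsilon>\<^sub>0 y then 1/4 else 1 :: real)"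
    using Y by (intro sum.cong refl) (simp add: prod.If_cases dist_def Int_def)
  also have "\<dots> = (\<Prod>y\<in>Y. (if 1 \<noteq> \<epsilon>\<^sub>0 y then 1/4 else 1) + (if -1 \<noteq> \<epsilon>\<^sub>0 y then 1/4 else 1))"
    using sum_signings_prod[OF Y(1), of "\<lambda>y z. if z \<noteq> \<epsilon>\<^sub>0 y then 1/4 else 1"] by simp
  also have "\<dots> = (\<Prod>y\<in>Y. 5/4)" 
  proof (rule prod.cong)
    fix y assume "y \<in> Y" thus "(if 1 \<noteq> \<epsilon>\<^sub>0 y then 1/4 else 1) + (if -1 \<noteq> \<epsilon>\<^sub>0 y then 1/4 else 1) = (5/4::real)"
      using signings_mem[OF e0, of y] by auto
  qed simp
  finally have tot: "(\<Sum>\<epsilon>\<in>signings Y. (1/4) ^ dist \<epsilon>) = (5/4::real) ^ m" by (simp add: m_def)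
  have "real (card B) * (1/\<beta>) ^ m = (\<Sum>\<epsilon>\<in>B. (1/\<beta>) ^ m)" by simp
  also have "\<dots> \<le> (\<Sum>\<epsilon>\<in>B. (1/4) ^ dist \<epsilon>)"
  proof (rule sum_mono)
    fix \<epsilon> assume "\<epsilon> \<in> B"
    hence d: "8 * dist \<epsilon> \<le> m" by (simp add: B_def)
    have "(1/\<beta>) ^ 8 = 1/4" using b4 power_mult[of \<beta> 4 2] by (simp add: power_divide)
    hence "(1/4) ^ dist \<epsilon> = (1/\<beta>) ^ (8 * dist \<epsilon>)" by (metis power_mult)
    moreover have "1 \<le> \<beta>" by (simp add: \<beta>_def ge_one_powr_ge_zero)
    ultimately show "(1/\<beta>) ^ m \<le> (1/4) ^ dist \<epsilon>" using d b0 by (auto intro!: power_decreasing)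
  qed
  also have "\<dots> \<le> (\<Sum>\<epsilon>\<in>signings Y. (1/4) ^ dist \<epsilon>)"
    using Y by (intro sum_mono2) (auto simp: B_def)
  finally have "real (card B) * (1/\<beta>) ^ m \<le> (5/4) ^ m" unfolding tot .
  hence "real (card B) \<le> (5/4 * \<beta>) ^ m" using b0
    by (simp add: power_divide power_mult_distrib field_simps)
  also have "(5/4 * \<beta>) ^ m < (2 * exp (-1/4)) ^ m"
  proof (rule power_strict_mono)
    \<comment> \<open>The fourth power removes the roots and leaves 625/128 < 16/e.\<close>
    have "(5/4 * \<beta>) ^ 4 < (2 * exp (-1/4)) ^ 4"
    proof -
      have "(2 * exp (-1/4)) ^ 4 = 16 * exp (-1::real)"
        by (simp add: power_mult_distrib flip: exp_of_nat_mult)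
      moreover have "exp (1::real) < 272/100" using e_less_272 by simp
      ultimately show ?thesis using b4 by (simp add: power_mult_distrib exp_minus field_simps)
    qed
    thus "5/4 * \<beta> < 2 * exp (-1/4)" by (rule power_less_imp_less_base) simp
  qed (use b0 m in auto)
  also have "\<dots> = 2 ^ m * exp (- real m / 4)"
    by (simp add: power_mult_distrib flip: exp_of_nat_mult)
  finally show ?thesis by (simp add: B_def dist_def m_def)
qed

text \<open>Some fibre of the rounded sums is too large for a Hamming ball of radius |Y|/8, so it
  contains two signings differing in more than |Y|/8 places. Half their difference is the partial
  colouring: both sums over a set lie in the same bin of width 2\<Delta>, so half the difference is
  at most \<Delta>.\<close>

lemma partial_colouring:
  fixes S :: "'i \<Rightarrow> 'a set" and L s :: "'i \<Rightarrow> real"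
  assumes Y: "finite Y" "Y \<noteq> {}" and I: "finite I"
    and S: "\<And>i. i \<in> I \<Longrightarrow> S i \<subseteq> Y" "\<And>i. i \<in> I \<Longrightarrow> real (card (S i)) \<le> s i" "\<And>i. i \<in> I \<Longrightarrow> s i > 0"
    and L: "\<And>i. i \<in> I \<Longrightarrow> L i \<ge> 2"
    and cost: "(\<Sum>i\<in>I. (L i + 4) * exp (- L i / 2)) \<le> real (card Y) / 4"
  shows "\<exists>\<eta> :: 'a \<Rightarrow> real. (\<forall>y\<in>Y. \<eta> y \<in> {-1, 0, 1}) \<and> 8 * card {y\<in>Y. \<eta> y \<noteq> 0} \<ge> card Y
           \<and> (\<forall>i\<in>I. \<bar>\<Sum>y\<in>S i. \<eta> y\<bar> \<le> sqrt (L i * s i))"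
proof -
  define b where "b i \<epsilon> = round ((\<Sum>y\<in>S i. \<epsilon> y) / (2 * sqrt (L i * s i)))" for i and \<epsilon> :: "'a \<Rightarrow> real"
  have ne: "signings Y \<noteq> {}" by (auto simp: signings_def PiE_eq_empty_iff)
  have "\<exists>v. real (card (signings Y)) * exp (- (real (card Y) / 4)) \<le> real (card {\<epsilon>\<in>signings Y. \<forall>i\<in>I. b i \<epsilon> = v i})"
  proof (rule ex_large_fibre[OF I _ ne L _ cost])
    fix i assume i: "i \<in> I"
    have "1 \<le> L i" using L[OF i] by linarith
    from sum_signings_round_le[OF Y(1) S(1)[OF i] S(2)[OF i] S(3)[OF i] this]
    show "(\<Sum>\<epsilon>\<in>signings Y. of_int \<bar>b i \<epsilon>\<bar>) \<le> real (card (signings Y)) * (2 * exp (- L i / 2))"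
      by (simp add: b_def)
  qed (use Y in auto)
  then obtain v where v: "2 ^ card Y * exp (- real (card Y) / 4) \<le> real (card {\<epsilon>\<in>signings Y. \<forall>i\<in>I. b i \<epsilon> = v i})"
    using Y by (auto simp: card_signings)
  define F where "F = {\<epsilon>\<in>signings Y. \<forall>i\<in>I. b i \<epsilon> = v i}"
  have "0 < real (card F)" unfolding F_def by (rule less_le_trans[OF _ v]) simp
  then obtain \<epsilon>0 where e0: "\<epsilon>0 \<in> F" by (metis all_not_in_conv card.empty less_irrefl of_nat_0)
  have e0s: "\<epsilon>0 \<in> signings Y" using e0 by (simp add: F_def)
  have "\<not> F \<subseteq> {\<epsilon>\<in>signings Y. 8 * card {y\<in>Y. \<epsilon> y \<noteq> \<epsilon>0 y} \<le> card Y}"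
  proof
    assume "F \<subseteq> {\<epsilon>\<in>signings Y. 8 * card {y\<in>Y. \<epsilon> y \<noteq> \<epsilon>0 y} \<le> card Y}"
    hence "card F \<le> card {\<epsilon>\<in>signings Y. 8 * card {y\<in>Y. \<epsilon> y \<noteq> \<epsilon>0 y} \<le> card Y}"
      using Y by (intro card_mono) auto
    with card_hamming_ball_less[OF Y e0s] v show False by (simp add: F_def)
  qed
  then obtain \<epsilon>1 where e1: "\<epsilon>1 \<in> F" "\<epsilon>1 \<notin> {\<epsilon>\<in>signings Y. 8 * card {y\<in>Y. \<epsilon> y \<noteq> \<epsilon>0 y} \<le> card Y}"
    by blast
  have e1s: "\<epsilon>1 \<in> signings Y" using e1 by (simp add: F_def)
  define \<eta> where "\<eta> y = (\<epsilon>1 y - \<epsilon>0 y) / 2" for y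
  show ?thesis
  proof (intro exI[of _ \<eta>] conjI ballI)
    fix y assume "y \<in> Y"
    thus "\<eta> y \<in> {-1, 0, 1}" using signings_mem[OF e0s, of y] signings_mem[OF e1s, of y] by (auto simp: \<eta>_def)
  next
    have "{y\<in>Y. \<eta> y \<noteq> 0} = {y\<in>Y. \<epsilon>1 y \<noteq> \<epsilon>0 y}" by (auto simp: \<eta>_def)
    thus "card Y \<le> 8 * card {y\<in>Y. \<eta> y \<noteq> 0}" using e1 e1s by simp
  next
    fix i assume i: "i \<in> I"
    define \<Delta> where "\<Delta> = sqrt (L i * s i)"
    have D: "\<Delta> > 0" using L[OF i] S(3)[OF i] by (auto simp: \<Delta>_def intro!: mult_pos_pos)
    have "round ((\<Sum>y\<in>S i. \<epsilon>1 y) / (2 * \<Delta>)) = round ((\<Sum>y\<in>S i. \<epsilon>0 y) / (2 * \<Delta>))"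
      using e0 e1 i by (simp add: F_def b_def \<Delta>_def)
    hence "\<bar>(\<Sum>y\<in>S i. \<epsilon>1 y) / (2 * \<Delta>) - (\<Sum>y\<in>S i. \<epsilon>0 y) / (2 * \<Delta>)\<bar> \<le> 1"
      using of_int_round_abs_le[of "(\<Sum>y\<in>S i. \<epsilon>1 y) / (2 * \<Delta>)"] of_int_round_abs_le[of "(\<Sum>y\<in>S i. \<epsilon>0 y) / (2 * \<Delta>)"]
      by linarith
    moreover have "(\<Sum>y\<in>S i. \<epsilon>1 y) / (2 * \<Delta>) - (\<Sum>y\<in>S i. \<epsilon>0 y) / (2 * \<Delta>) = (\<Sum>y\<in>S i. \<eta> y) / \<Delta>"
      using D by (simp add: \<eta>_def sum_subtractf field_simps flip: sum_divide_distrib)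
    ultimately have "\<bar>\<Sum>y\<in>S i. \<eta> y\<bar> / \<Delta> \<le> 1" using D by (simp add: abs_divide)
    thus "\<bar>\<Sum>y\<in>S i. \<eta> y\<bar> \<le> sqrt (L i * s i)" using D by (simp add: \<Delta>_def[symmetric])
  qed
qed

section \<open>Discrepancy of initial segments of many orderings\<close>

text \<open>Clear the binary digits of t from the lowest upwards. A digit 0 removes nothing; a digit
  1 at place i removes one block of length 2^i that ends at or below t. So one block per level
  suffices, and only blocks wholly below m need control.\<close>

lemma prefix_sum_le_dyadic:
  fixes g :: "'a \<Rightarrow> real" and \<rho> :: "'a \<Rightarrow> nat"
  assumes Y: "finite Y"
    and piece: "\<And>i j. i \<le> h \<Longrightarrow> j < m div 2 ^ i \<Longrightarrow> \<bar>\<Sum>y | y \<in> Y \<and> \<rho> y div 2 ^ i = j. g y\<bar> \<le> \<Delta> i"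
    and \<Delta>: "\<And>i. i \<le> h \<Longrightarrow> \<Delta> i \<ge> 0"
    and t: "t \<le> m" "t < 2 ^ Suc h"
  shows "\<bar>\<Sum>y | y \<in> Y \<and> \<rho> y < t. g y\<bar> \<le> (\<Sum>i\<le>h. \<Delta> i)"
proof -
  define P where "P i = (\<Sum>y | y \<in> Y \<and> \<rho> y < t div 2 ^ i * 2 ^ i. g y)" for i
  have step: "\<bar>P i - P (Suc i)\<bar> \<le> \<Delta> i" if i: "i \<le> h" for i
  proof -
    define q where "q = t div 2 ^ i"
    have q2: "t div 2 ^ Suc i = q div 2" by (metis div_mult2_eq power_Suc2 q_def)
    show ?thesis
    proof (cases "even q")
      case True
      hence "t div 2 ^ Suc i * 2 ^ Suc i = q * 2 ^ i" unfolding q2 by simp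
      hence "P (Suc i) = P i" by (simp add: P_def q_def del: power_Suc)
      thus ?thesis using \<Delta>[OF i] by simp
    next
      case False
      then obtain c where c: "q = 2 * c + 1" by (auto elim: oddE)
      have Ps: "P (Suc i) = (\<Sum>y | y \<in> Y \<and> \<rho> y < 2 * c * 2 ^ i. g y)"
        unfolding P_def q2 by (simp add: c mult_ac)
      have "{y. y \<in> Y \<and> \<rho> y < q * 2 ^ i} = {y. y \<in> Y \<and> \<rho> y < 2 * c * 2 ^ i} \<union> {y. y \<in> Y \<and> \<rho> y div 2 ^ i = 2 * c}"
      proof -
        have "x < q * 2 ^ i \<longleftrightarrow> x < 2 * c * 2 ^ i \<or> x div 2 ^ i = 2 * c" for x :: nat
          using div_less_iff_less_mult[of "2^i" x q] div_less_iff_less_mult[of "2^i" x "2*c"] by (simp add: c) linarith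
        thus ?thesis by blast
      qed
      moreover have "{y. y \<in> Y \<and> \<rho> y < 2 * c * 2 ^ i} \<inter> {y. y \<in> Y \<and> \<rho> y div 2 ^ i = 2 * c} = {}"
        by (auto simp flip: div_less_iff_less_mult)
      ultimately have "P i = P (Suc i) + (\<Sum>y | y \<in> Y \<and> \<rho> y div 2 ^ i = 2 * c. g y)"
        unfolding Ps unfolding P_def q_def[symmetric] using Y by (simp add: sum.union_disjoint)
      moreover have "q \<le> m div 2 ^ i" using t by (simp add: q_def div_le_mono)
      hence "2 * c < m div 2 ^ i" by (simp add: c)
      ultimately show ?thesis using piece[OF i, of "2*c"] by simp
    qed
  qed
  have "\<bar>P 0 - P (Suc i)\<bar> \<le> (\<Sum>j\<le>i. \<Delta> j)" if "i \<le> h" for i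
    using that
  proof (induction i)
    case 0 thus ?case using step[of 0] by simp
  next
    case (Suc i) thus ?case using step[of "Suc i"] by simp
  qed
  from this[of h] have "\<bar>P 0 - P (Suc h)\<bar> \<le> (\<Sum>j\<le>h. \<Delta> j)" by simp
  moreover have "P (Suc h) = 0" using t by (simp add: P_def)
  ultimately show ?thesis by (simp add: P_def)
qed

text \<open>With L = 49 sqrt u, the decay 1/u^2 says that (L + 4) exp(-L/2) L^4 is bounded, which
  follows from exp(L/10) \<ge> L/10. The constant works because 49^4 \<ge> 16 * 200000; being a
  square, it later leaves the factor 7.\<close>

lemma dyadic_cost_le:
  fixes u :: real
  assumes "u \<ge> 1"
  shows "(49 * sqrt u + 4) * exp (- (49 * sqrt u) / 2) \<le> 1 / (16 * u\<^sup>2)"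
proof -
  define L where "L = 49 * sqrt u"
  have L: "L \<ge> 49" using assms by (simp add: L_def)
  have L4: "L ^ 4 = 5764801 * u\<^sup>2"
  proof -
    have "sqrt u ^ 4 = (sqrt u ^ 2) ^ 2" by (simp flip: power_mult)
    thus ?thesis using assms by (simp add: L_def power_mult_distrib)
  qed
  have "(L/10) ^ 5 \<le> exp (L/10) ^ 5"
    using L exp_ge_add_one_self[of "L/10"] by (intro power_mono) linarith+
  also have "\<dots> = exp (L/2)" by (simp flip: exp_of_nat_mult)
  finally have e: "L ^ 5 \<le> 100000 * exp (L/2)" by (simp add: power_divide)
  have "(L + 4) * exp (- L / 2) * L ^ 4 \<le> (2 * L) * exp (- L / 2) * L ^ 4"
    using L by (intro mult_right_mono) auto
  also have "\<dots> = 2 * L ^ 5 * exp (- L / 2)" by (simp add: power_numeral_reduce)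
  also have "\<dots> \<le> 2 * (100000 * exp (L/2)) * exp (- L / 2)"
    using e by (intro mult_right_mono mult_left_mono) auto
  also have "\<dots> = 200000" by (simp flip: exp_add)
  finally have "(L + 4) * exp (- L / 2) * u\<^sup>2 \<le> 1 / 16" by (simp add: L4)
  thus ?thesis using assms by (simp add: L_def field_simps)
qed

text \<open>Allows a ranking to be compressed to consecutive ranks without changing its initial
  segments; only then is the number of dyadic blocks governed by |Y|.\<close>

lemma card_less_rank_iff:
  fixes r :: "'a \<Rightarrow> nat"
  assumes "finite Y" "y \<in> Y"
  shows "card {z\<in>Y. r z < r y} < card {z\<in>Y. r z < t} \<longleftrightarrow> r y < t"
proof
  assume "r y < t"
  hence "{z\<in>Y. r z < r y} \<subset> {z\<in>Y. r z < t}" using assms by auto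
  thus "card {z\<in>Y. r z < r y} < card {z\<in>Y. r z < t}" using assms by (intro psubset_card_mono) auto
next
  assume *: "card {z\<in>Y. r z < r y} < card {z\<in>Y. r z < t}"
  show "r y < t"
  proof (rule ccontr)
    assume "\<not> r y < t"
    hence "card {z\<in>Y. r z < t} \<le> card {z\<in>Y. r z < r y}" using assms by (intro card_mono) auto
    with * show False by simp
  qed
qed

text \<open>Each order contributes at most m / 2^i blocks of length 2^i, and these are allowed discrepancy
  of order (K * 2^i) to the power 1/4: more than the standard deviation of the block, by
  a margin that pays for the number of blocks, yet summable over the levels i.\<close>

lemma partial_colouring_prefixes:
  fixes r :: "'d \<Rightarrow> 'a \<Rightarrow> nat" and K :: real
  assumes Y: "finite Y" "Y \<noteq> {}" "real (card Y) \<le> K"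
    and D: "finite D" "real (card D) \<le> K"
    and r: "\<And>d. d \<in> D \<Longrightarrow> inj_on (r d) Y"
  defines "\<theta> \<equiv> sqrt (sqrt 2)"
  shows "\<exists>\<eta> :: 'a \<Rightarrow> real. (\<forall>y\<in>Y. \<eta> y \<in> {-1, 0, 1}) \<and> 8 * card {y\<in>Y. \<eta> y \<noteq> 0} \<ge> card Y
           \<and> (\<forall>d\<in>D. \<forall>t. \<bar>\<Sum>y | y \<in> Y \<and> r d y < t. \<eta> y\<bar> \<le> 7 * \<theta> / (\<theta> - 1) * sqrt (sqrt (K * real (card Y))))"
proof -
  define m where "m = card Y"
  have m: "m > 0" using Y by (simp add: m_def card_gt_0_iff)
  have K: "K \<ge> 1" "real m \<le> K" using m Y unfolding m_def by linarith+
  obtain h where h: "2 ^ h \<le> m" "m < 2 ^ Suc h"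
    using ex_power_ivl1[of 2 m] m by auto
  define \<rho> where "\<rho> d y = card {z\<in>Y. r d z < r d y}" for d y
  define I where "I = (SIGMA d:D. SIGMA i:{..h}. {..<m div 2 ^ i})"
  define S where "S = (\<lambda>(d, i, j). {y. y \<in> Y \<and> \<rho> d y div 2 ^ i = j})"
  define s where "s = (\<lambda>(d::'d, i::nat, j::nat). 2 ^ i :: real)"
  define c where "c i = (49 * sqrt (K / 2 ^ i) + 4) * exp (- (49 * sqrt (K / 2 ^ i)) / 2)" for i :: nat
  define L where "L = (\<lambda>(d::'d, i::nat, j::nat). 49 * sqrt (K / 2 ^ i))"
  have u: "K / 2 ^ i \<ge> 1" if "i \<le> h" for i
  proof -
    have "(2::real) ^ i \<le> 2 ^ h" using that by (intro power_increasing) auto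
    also have "\<dots> \<le> real m" using h(1) by (metis of_nat_le_iff of_nat_numeral of_nat_power)
    finally have "2 ^ i \<le> K" using K(2) by linarith
    thus ?thesis by simp
  qed
  have finI: "finite I" using D by (auto simp: I_def)
  have Iel: "i \<in> I \<longleftrightarrow> (\<exists>d i' j. i = (d,i',j) \<and> d \<in> D \<and> i' \<le> h \<and> j < m div 2 ^ i')" for i
    by (auto simp: I_def)
  have inj\<rho>: "inj_on (\<rho> d) Y" if d: "d \<in> D" for d
  proof (rule inj_onI)
    fix y z assume yz: "y \<in> Y" "z \<in> Y" "\<rho> d y = \<rho> d z"
    hence "\<not> r d y < r d z" "\<not> r d z < r d y"
      using card_less_rank_iff[OF Y(1) yz(1), of "r d" "r d z"] card_less_rank_iff[OF Y(1) yz(2), of "r d" "r d y"]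
      by (auto simp: \<rho>_def)
    thus "y = z" using r[OF d] yz by (auto simp: inj_on_def)
  qed
  have cost: "(\<Sum>i\<in>I. (L i + 4) * exp (- L i / 2)) \<le> real (card Y) / 4"
  proof -
    have "(\<Sum>x\<in>I. (L x + 4) * exp (- L x / 2)) = (\<Sum>x\<in>I. c (fst (snd x)))"
      by (intro sum.cong) (auto simp: L_def c_def)
    also have "\<dots> = (\<Sum>d\<in>D. \<Sum>z\<in>(SIGMA i:{..h}. {..<m div 2 ^ i}). c (fst z))"
      unfolding I_def using D by (subst sum.Sigma) (auto simp: split_def)
    also have "(\<Sum>z\<in>(SIGMA i:{..h}. {..<m div 2 ^ i}). c (fst z)) = (\<Sum>i\<le>h. \<Sum>j<m div 2 ^ i. c i)"
      by (subst sum.Sigma) (auto simp: split_def)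
    also have "(\<Sum>d\<in>D. \<dots>) = (\<Sum>d\<in>D. \<Sum>i\<le>h. real (m div 2 ^ i) * c i)" by simp
    also have "\<dots> = real (card D) * (\<Sum>i\<le>h. real (m div 2 ^ i) * c i)" by simp
    also have "\<dots> \<le> K * (\<Sum>i\<le>h. real (m div 2 ^ i) * c i)"
      using D K by (intro mult_right_mono sum_nonneg) (auto simp: c_def)
    also have "\<dots> = (\<Sum>i\<le>h. K * (real (m div 2 ^ i) * c i))" by (simp add: sum_distrib_left)
    \<comment> \<open>K orders with m/2^i blocks each, at cost 1/(16 (K/2^i)^2) per block, give m
      2^i / (16 K) at level i; the geometric sum over i is at most m/8.\<close>
    also have "\<dots> \<le> (\<Sum>i\<le>h. real m / (16 * K) * 2 ^ i)"
    proof (rule sum_mono)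
      fix i assume "i \<in> {..h}"
      hence i: "i \<le> h" by simp
      have "real (m div 2 ^ i) \<le> real m / 2 ^ i"
        using of_nat_div_le_of_nat[of m "2^i"] by simp
      hence "K * (real (m div 2 ^ i) * c i) \<le> K * ((real m / 2 ^ i) * (1 / (16 * (K / 2 ^ i)\<^sup>2)))"
        using K dyadic_cost_le[OF u[OF i]] by (intro mult_left_mono mult_mono) (auto simp: c_def)
      also have "\<dots> = real m / (16 * K) * 2 ^ i" using K by (simp add: power2_eq_square field_simps)
      finally show "K * (real (m div 2 ^ i) * c i) \<le> real m / (16 * K) * 2 ^ i" .
    qed
    also have "\<dots> = real m / (16 * K) * (\<Sum>i\<le>h. 2 ^ i)" by (simp add: sum_distrib_left)
    also have "(\<Sum>i\<le>h. (2::real) ^ i) = 2 ^ Suc h - 1" by (induction h) auto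
    also have "real m / (16 * K) * (2 ^ Suc h - 1) \<le> real m / (16 * K) * (2 * K)"
    proof (intro mult_left_mono)
      have "(2::real) ^ h \<le> real m" using h(1) by (metis of_nat_le_iff of_nat_numeral of_nat_power)
      thus "2 ^ Suc h - 1 \<le> 2 * K" using K(2) unfolding power_Suc by linarith
    qed (use K in auto)
    also have "\<dots> = real m / 8" using K by simp
    finally show ?thesis by (simp add: m_def)
  qed
  have "\<exists>\<eta> :: 'a \<Rightarrow> real. (\<forall>y\<in>Y. \<eta> y \<in> {-1, 0, 1}) \<and> 8 * card {y\<in>Y. \<eta> y \<noteq> 0} \<ge> card Y
           \<and> (\<forall>i\<in>I. \<bar>\<Sum>y\<in>S i. \<eta> y\<bar> \<le> sqrt (L i * s i))"
  proof (rule partial_colouring[OF Y(1,2) finI _ _ _ _ cost])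
    fix i assume "i \<in> I"
    then obtain d i' j where i: "i = (d,i',j)" "d \<in> D" "i' \<le> h" by (auto simp: Iel)
    show "S i \<subseteq> Y" by (auto simp: i S_def)
    show "s i > 0" by (simp add: i s_def)
    show "L i \<ge> 2"
    proof -
      have "sqrt (K / 2 ^ i') \<ge> 1" using u[OF i(3)] by simp
      thus ?thesis unfolding i L_def prod.case by linarith
    qed
    have "card (S i) = card (\<rho> d ` S i)"
      using inj\<rho>[OF i(2)] by (intro card_image[symmetric]) (auto simp: i S_def inj_on_def)
    also have "\<dots> \<le> card {j * 2 ^ i'..<j * 2 ^ i' + 2 ^ i'}"
    proof (intro card_mono)
      have "x \<in> {x div 2 ^ i' * 2 ^ i'..<x div 2 ^ i' * 2 ^ i' + 2 ^ i'}" for x :: nat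
        using dividend_less_div_times[of "2 ^ i'" x] by (simp add: add.commute)
      thus "\<rho> d ` S i \<subseteq> {j * 2 ^ i'..<j * 2 ^ i' + 2 ^ i'}" by (auto simp: i S_def)
    qed simp
    finally have "card (S i) \<le> 2 ^ i'" by simp
    thus "real (card (S i)) \<le> s i" by (simp add: i s_def)
  qed
  then obtain \<eta> :: "'a \<Rightarrow> real" where \<eta>: "\<forall>y\<in>Y. \<eta> y \<in> {-1, 0, 1}" "8 * card {y\<in>Y. \<eta> y \<noteq> 0} \<ge> card Y"
    "\<And>i. i \<in> I \<Longrightarrow> \<bar>\<Sum>y\<in>S i. \<eta> y\<bar> \<le> sqrt (L i * s i)" by blast
  define \<Delta> where "\<Delta> i = 7 * sqrt (sqrt K) * \<theta> ^ i" for i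
  have \<theta>: "\<theta> > 1" by (simp add: \<theta>_def)
  \<comment> \<open>The bound \<open>sqrt (L * s)\<close> at level i is 7 (K 2^i)^(1/4), and
    \<theta> is the fourth root of 2.\<close>
  have \<Delta>: "sqrt (49 * sqrt (K / 2 ^ i) * 2 ^ i) = \<Delta> i" for i :: nat
  proof -
    have "(2::real) ^ i = sqrt (2 ^ i) * sqrt (2 ^ i)" by simp
    hence "sqrt (K / 2 ^ i) * 2 ^ i = sqrt K * sqrt (2 ^ i)"
      by (simp add: real_sqrt_divide field_simps)
    hence "49 * sqrt (K / 2 ^ i) * 2 ^ i = 7\<^sup>2 * (sqrt K * sqrt (2 ^ i))" by simp
    thus ?thesis by (simp only: real_sqrt_mult) (simp add: \<Delta>_def \<theta>_def real_sqrt_power)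
  qed
  show ?thesis
  proof (intro exI[of _ \<eta>] conjI \<eta> ballI allI)
    fix d t assume d: "d \<in> D"
    define t' where "t' = card {z\<in>Y. r d z < t}"
    have "{y. y \<in> Y \<and> r d y < t} = {y. y \<in> Y \<and> \<rho> d y < t'}"
      using card_less_rank_iff[OF Y(1), of _ "r d" t] by (auto simp: \<rho>_def t'_def)
    moreover have "\<bar>\<Sum>y | y \<in> Y \<and> \<rho> d y < t'. \<eta> y\<bar> \<le> (\<Sum>i\<le>h. \<Delta> i)"
    proof (rule prefix_sum_le_dyadic[OF Y(1)])
      fix i j assume "i \<le> h" "j < m div 2 ^ i"
      hence "(d, i, j) \<in> I" using d by (simp add: Iel)
      from \<eta>(3)[OF this] show "\<bar>\<Sum>y | y \<in> Y \<and> \<rho> d y div 2 ^ i = j. \<eta> y\<bar> \<le> \<Delta> i"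
        by (simp add: S_def L_def s_def \<Delta>)
    next
      show "t' \<le> m" unfolding t'_def m_def using Y by (intro card_mono) auto
      thus "t' < 2 ^ Suc h" using h by simp
    qed (use K \<theta> in \<open>auto simp: \<Delta>_def\<close>)
    moreover have "(\<Sum>i\<le>h. \<Delta> i) \<le> 7 * \<theta> / (\<theta> - 1) * sqrt (sqrt (K * real m))"
    proof -
      \<comment> \<open>The top level dominates the geometric sum, and 2^h \<le> m turns (K
        2^h)^(1/4) into (K m)^(1/4).\<close>
      have geo: "(\<theta> - 1) * (\<Sum>i\<le>h. \<theta> ^ i) \<le> \<theta> * \<theta> ^ h"
        by (induction h) (auto simp: algebra_simps)
      have "\<theta> ^ h = sqrt (sqrt (2 ^ h))" by (simp add: \<theta>_def real_sqrt_power)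
      also have "\<dots> \<le> sqrt (sqrt (real m))"
        using h(1) by (metis of_nat_le_iff of_nat_numeral of_nat_power real_sqrt_le_iff)
      finally have "(\<theta> - 1) * (\<Sum>i\<le>h. \<theta> ^ i) \<le> \<theta> * sqrt (sqrt (real m))"
        using geo \<theta> by (smt (verit) mult_left_mono)
      hence "(\<Sum>i\<le>h. \<theta> ^ i) \<le> \<theta> / (\<theta> - 1) * sqrt (sqrt (real m))"
        using \<theta> by (simp add: field_simps)
      hence "7 * sqrt (sqrt K) * (\<Sum>i\<le>h. \<theta> ^ i) \<le> 7 * sqrt (sqrt K) * (\<theta> / (\<theta> - 1) * sqrt (sqrt (real m)))"
        using K by (intro mult_left_mono) auto
      thus ?thesis by (simp add: \<Delta>_def sum_distrib_left real_sqrt_mult mult_ac)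
    qed
    ultimately show "\<bar>\<Sum>y | y \<in> Y \<and> r d y < t. \<eta> y\<bar> \<le> 7 * \<theta> / (\<theta> - 1) * sqrt (sqrt (K * real (card Y)))"
      by (simp add: m_def)
  qed
qed

text \<open>Partial colouring is repeated on the elements still at 0, at most 7/8 of the previous
  ones. \<open>D\<close> does not shrink, so K stays fixed, but the error C1 (K |Y|)^(1/4) of a
  round falls by the factor \<gamma> = (7/8)^(1/4), and all rounds together cost a constant multiple
  of the first.\<close>

theorem prefix_discrepancy:
  obtains C :: real where "C > 0"
    "\<And>(Y :: 'a set) (D :: 'd set) (r :: 'd \<Rightarrow> 'a \<Rightarrow> nat) K. \<lbrakk>finite Y; real (card Y) \<le> K; finite D; real (card D) \<le> K;
        \<And>d. d \<in> D \<Longrightarrow> inj_on (r d) Y\<rbrakk> \<Longrightarrow>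
      \<exists>\<eta> :: 'a \<Rightarrow> real. (\<forall>y\<in>Y. \<eta> y \<in> {-1, 1}) \<and>
        (\<forall>d\<in>D. \<forall>t. \<bar>\<Sum>y | y \<in> Y \<and> r d y < t. \<eta> y\<bar> \<le> C * sqrt K)"
proof -
  define \<theta> :: real where "\<theta> = sqrt (sqrt 2)"
  define \<gamma> :: real where "\<gamma> = sqrt (sqrt (7/8))"
  define C1 where "C1 = 7 * \<theta> / (\<theta> - 1)"
  define C where "C = C1 / (1 - \<gamma>)"
  have \<gamma>: "0 < \<gamma>" "\<gamma> < 1" by (auto simp: \<gamma>_def)
  have "\<theta> > 1" by (simp add: \<theta>_def)
  hence C1: "C1 > 0" by (simp add: C1_def)
  have C: "C > 0" "C1 + C * \<gamma> = C" using C1 \<gamma> by (auto simp: C_def field_simps)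
  \<comment> \<open>The finer bound, with |Y| inside the root, is what the induction needs: a bound
    by sqrt K alone would not profit from the shrinking set. \<open>C1 + C * \<gamma> = C\<close>
    closes the step.\<close>
  have main: "\<exists>\<eta> :: 'a \<Rightarrow> real. (\<forall>y\<in>Y. \<eta> y \<in> {-1, 1}) \<and>
        (\<forall>d\<in>D. \<forall>t. \<bar>\<Sum>y | y \<in> Y \<and> r d y < t. \<eta> y\<bar> \<le> C * sqrt (sqrt (K * real (card Y))))"
    if "finite Y" "real (card Y) \<le> K" "finite D" "real (card D) \<le> K" "\<And>d. d \<in> D \<Longrightarrow> inj_on (r d) Y"
    for Y :: "'a set" and D :: "'d set" and r :: "'d \<Rightarrow> 'a \<Rightarrow> nat" and K :: real
    using that
  proof (induction "card Y" arbitrary: Y rule: less_induct)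
    case (less Y)
    show ?case
    proof (cases "Y = {}")
      case False
      obtain \<eta> :: "'a \<Rightarrow> real" where \<eta>: "\<forall>y\<in>Y. \<eta> y \<in> {-1, 0, 1}" "8 * card {y\<in>Y. \<eta> y \<noteq> 0} \<ge> card Y"
        "\<And>d t. d \<in> D \<Longrightarrow> \<bar>\<Sum>y | y \<in> Y \<and> r d y < t. \<eta> y\<bar> \<le> C1 * sqrt (sqrt (K * real (card Y)))"
        using partial_colouring_prefixes[OF less.prems(1) False less.prems(2,3,4), of r] less.prems(5)
        unfolding C1_def \<theta>_def by blast
      define Z where "Z = {y\<in>Y. \<eta> y = 0}"
      have ZY: "Z \<subseteq> Y" by (auto simp: Z_def)
      have cZ: "card Y = card Z + card {y\<in>Y. \<eta> y \<noteq> 0}"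
        using less.prems(1) unfolding Z_def
        by (subst card_Un_disjoint[symmetric]) (auto intro: arg_cong[where f = card])
      have Y0: "card Y > 0" using False less.prems(1) by (simp add: card_gt_0_iff)
      have Zc: "8 * card Z \<le> 7 * card Y" "card Z < card Y" using cZ \<eta>(2) Y0 by linarith+
      have fZ: "finite Z" using ZY less.prems(1) finite_subset by blast
      have ZK: "real (card Z) \<le> K" using Zc(2) less.prems(2) by linarith
      have iZ: "inj_on (r d) Z" if "d \<in> D" for d using less.prems(5)[OF that] ZY inj_on_subset by blast
      obtain \<zeta> :: "'a \<Rightarrow> real" where \<zeta>: "\<forall>y\<in>Z. \<zeta> y \<in> {-1, 1}"
        "\<And>d t. d \<in> D \<Longrightarrow> \<bar>\<Sum>y | y \<in> Z \<and> r d y < t. \<zeta> y\<bar> \<le> C * sqrt (sqrt (K * real (card Z)))"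
        using less.hyps[OF Zc(2) fZ ZK less.prems(3,4) iZ] by blast
      define \<omega> where "\<omega> y = (if y \<in> Z then \<zeta> y else \<eta> y)" for y
      have K: "K \<ge> 0" using ZK by linarith
      show ?thesis
      proof (intro exI[of _ \<omega>] conjI ballI allI)
        fix y assume "y \<in> Y" thus "\<omega> y \<in> {-1, 1}" using \<eta>(1) \<zeta>(1) by (auto simp: \<omega>_def Z_def)
      next
        fix d t assume d: "d \<in> D"
        have "(\<Sum>y | y \<in> Y \<and> r d y < t. \<omega> y) = (\<Sum>y | y \<in> Y \<and> r d y < t. \<eta> y + (if y \<in> Z then \<zeta> y else 0))"
          by (intro sum.cong) (auto simp: \<omega>_def Z_def)
        also have "\<dots> = (\<Sum>y | y \<in> Y \<and> r d y < t. \<eta> y) + (\<Sum>y | y \<in> Z \<and> r d y < t. \<zeta> y)"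
        proof -
          have "{y. y \<in> Y \<and> r d y < t} \<inter> Z = {y. y \<in> Z \<and> r d y < t}" using ZY by auto
          thus ?thesis using less.prems(1) by (simp add: sum.distrib sum.inter_restrict[symmetric])
        qed
        finally have "\<bar>\<Sum>y | y \<in> Y \<and> r d y < t. \<omega> y\<bar> \<le> C1 * sqrt (sqrt (K * real (card Y))) + C * sqrt (sqrt (K * real (card Z)))"
          using \<eta>(3)[OF d, of t] \<zeta>(2)[OF d, of t] by linarith
        also have "C * sqrt (sqrt (K * real (card Z))) \<le> C * sqrt (sqrt (7/8 * (K * real (card Y))))"
        proof -
          have "real (card Z) \<le> 7/8 * real (card Y)" using Zc(1) by linarith
          hence "K * real (card Z) \<le> K * (7/8 * real (card Y))" using K by (rule mult_left_mono)
          thus ?thesis using C(1) by simp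
        qed
        also have "\<dots> = C * \<gamma> * sqrt (sqrt (K * real (card Y)))"
          by (simp only: \<gamma>_def real_sqrt_mult mult.assoc)
        finally show "\<bar>\<Sum>y | y \<in> Y \<and> r d y < t. \<omega> y\<bar> \<le> C * sqrt (sqrt (K * real (card Y)))"
          using C(2) by (simp flip: distrib_right)
      qed
    qed simp
  qed
  show ?thesis
  proof (rule that[OF C(1)])
    fix Y :: "'a set" and D :: "'d set" and r :: "'d \<Rightarrow> 'a \<Rightarrow> nat" and K :: real
    assume a: "finite Y" "real (card Y) \<le> K" "finite D" "real (card D) \<le> K" "\<And>d. d \<in> D \<Longrightarrow> inj_on (r d) Y"
    have K: "K \<ge> 0" using a(2) by linarith
    have "sqrt (sqrt (K * real (card Y))) \<le> sqrt K"
    proof -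
      have "K * real (card Y) \<le> K * K" using a(2) K by (intro mult_left_mono) auto
      hence "sqrt (K * real (card Y)) \<le> K" using K by (intro real_le_lsqrt) (auto simp: power2_eq_square)
      thus ?thesis by simp
    qed
    hence le: "C * sqrt (sqrt (K * real (card Y))) \<le> C * sqrt K" using C by simp
    obtain \<eta> :: "'a \<Rightarrow> real" where "\<forall>y\<in>Y. \<eta> y \<in> {-1, 1}"
      "\<forall>d\<in>D. \<forall>t. \<bar>\<Sum>y | y \<in> Y \<and> r d y < t. \<eta> y\<bar> \<le> C * sqrt (sqrt (K * real (card Y)))"
      using main[where Y = Y and D = D and r = r and K = K, OF a] by auto
    thus "\<exists>\<eta> :: 'a \<Rightarrow> real. (\<forall>y\<in>Y. \<eta> y \<in> {-1, 1}) \<and>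
        (\<forall>d\<in>D. \<forall>t. \<bar>\<Sum>y | y \<in> Y \<and> r d y < t. \<eta> y\<bar> \<le> C * sqrt K)"
      using le by (intro exI[of _ \<eta>]) (auto intro: order_trans)
  qed
qed

section \<open>Balancing cosets by opposite signs on consecutive positions\<close>

lemma sum_lessThan_pairs:
  fixes h :: "nat \<Rightarrow> real"
  shows "(\<Sum>z<N. h z) = (\<Sum>j<N div 2. h (2 * j) + h (2 * j + 1)) + (if odd N then h (N - 1) else 0)"
proof -
  have ev: "(\<Sum>z<2 * M. h z) = (\<Sum>j<M. h (2 * j) + h (2 * j + 1))" for M
    by (induction M) (auto simp: algebra_simps)
  show ?thesis
  proof (cases "even N")
    case True
    then obtain M where "N = 2 * M" by (rule evenE)
    thus ?thesis using ev[of M] by simp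
  next
    case False
    then obtain M where "N = 2 * M + 1" by (rule oddE)
    thus ?thesis using ev[of M] by simp
  qed
qed

text \<open>\<sigma> assigns positions, and positions 2j and 2j+1 get opposite signs, so initial
  segments of positions have sum at most 1 in absolute value and intervals at most 2. An initial
  segment of \<open>R d\<close> splits into its even and its odd positions; each half is an initial
  segment of an ordering of the pairs, where \<open>prefix_discrepancy\<close> applies.\<close>

lemma balanced_prefix_colouring:
  obtains C :: real where "C > 0"
    "\<And>N (\<sigma> :: nat \<Rightarrow> nat) (R :: nat \<Rightarrow> nat \<Rightarrow> nat).
       \<lbrakk>N > 0; bij_betw \<sigma> {..<N} {..<N}; \<And>d. d < N \<Longrightarrow> inj_on (R d) {..<N}\<rbrakk> \<Longrightarrow>
       \<exists>f :: nat \<Rightarrow> real. (\<forall>x<N. f x \<in> {-1, 1}) \<and>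
         (\<forall>a b. a \<le> b \<longrightarrow> b \<le> N \<longrightarrow> \<bar>\<Sum>x | x < N \<and> \<sigma> x \<in> {a..<b}. f x\<bar> \<le> 2) \<and>
         (\<forall>d<N. \<forall>t. \<bar>\<Sum>x | x < N \<and> R d x < t. f x\<bar> \<le> C * sqrt N)"
proof -
  obtain C :: real where C: "C > 0" and disc:
    "\<And>(Y :: nat set) (D :: (nat \<times> nat) set) r K. \<lbrakk>finite Y; real (card Y) \<le> K; finite D; real (card D) \<le> K;
        \<And>d. d \<in> D \<Longrightarrow> inj_on (r d :: nat \<Rightarrow> nat) Y\<rbrakk> \<Longrightarrow>
      \<exists>\<eta> :: nat \<Rightarrow> real. (\<forall>y\<in>Y. \<eta> y \<in> {-1, 1}) \<and>
        (\<forall>d\<in>D. \<forall>t. \<bar>\<Sum>y | y \<in> Y \<and> r d y < t. \<eta> y\<bar> \<le> C * sqrt K)"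
    using prefix_discrepancy by blast
  show ?thesis
  proof (rule that[of "2 * C * sqrt 2 + 1"])
    show "2 * C * sqrt 2 + 1 > 0" using C by (simp add: add_pos_pos)
    fix N :: nat and \<sigma> :: "nat \<Rightarrow> nat" and R :: "nat \<Rightarrow> nat \<Rightarrow> nat"
    assume N: "N > 0" and \<sigma>: "bij_betw \<sigma> {..<N} {..<N}" and R: "\<And>d. d < N \<Longrightarrow> inj_on (R d) {..<N}"
    define \<tau> where "\<tau> = the_inv_into {..<N} \<sigma>"
    have \<tau>: "bij_betw \<tau> {..<N} {..<N}" unfolding \<tau>_def using \<sigma> by (rule bij_betw_the_inv_into)
    have \<tau>\<sigma>: "\<tau> (\<sigma> x) = x" if "x < N" for x
      unfolding \<tau>_def using \<sigma> that by (intro the_inv_into_f_f) (auto simp: bij_betw_def)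
    have \<sigma>\<tau>: "\<sigma> (\<tau> z) = z" if "z < N" for z
      unfolding \<tau>_def using \<sigma> that by (intro f_the_inv_into_f) (auto simp: bij_betw_def)
    have \<tau>N: "\<tau> z < N" if "z < N" for z using \<tau> that by (auto simp: bij_betw_def)
    \<comment> \<open>Pair j is ranked by its member at position 2j + e. These are 2N orderings,
      hence the parameter 2N below.\<close>
    define r where "r = (\<lambda>(d, e) j. R d (\<tau> (2 * j + e)))"
    have "\<exists>\<eta> :: nat \<Rightarrow> real. (\<forall>y\<in>{..<N div 2}. \<eta> y \<in> {-1, 1}) \<and>
        (\<forall>d\<in>{..<N} \<times> {0, 1}. \<forall>t. \<bar>\<Sum>y | y \<in> {..<N div 2} \<and> r d y < t. \<eta> y\<bar> \<le> C * sqrt (2 * real N))"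
    proof (rule disc)
      fix d :: "nat \<times> nat" assume "d \<in> {..<N} \<times> {0, 1}"
      then obtain d' e where d: "d = (d', e)" "d' < N" "e \<le> 1" by auto
      show "inj_on (r d) {..<N div 2}"
      proof (rule inj_onI)
        fix i j assume ij: "i \<in> {..<N div 2}" "j \<in> {..<N div 2}" "r d i = r d j"
        have lt: "2 * i + e < N" "2 * j + e < N" using ij d by auto
        have "\<tau> (2 * i + e) = \<tau> (2 * j + e)"
          using inj_onD[OF R[OF d(2)], of "\<tau> (2 * i + e)" "\<tau> (2 * j + e)"] ij(3) lt \<tau>N by (auto simp: r_def d)
        hence "2 * i + e = 2 * j + e" using \<sigma>\<tau> lt by metis
        thus "i = j" by simp
      qed
    next
      show "real (card {..<N div 2}) \<le> 2 * real N" by (simp add: le_trans[OF div_le_dividend])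
      show "real (card ({..<N} \<times> {0, 1::nat})) \<le> 2 * real N" by (simp add: card_cartesian_product)
    qed auto
    then obtain \<eta> :: "nat \<Rightarrow> real" where \<eta>_sign: "\<forall>j\<in>{..<N div 2}. \<eta> j \<in> {-1, 1}" and \<eta>_disc:
      "\<forall>d\<in>{..<N} \<times> {0, 1}. \<forall>t. \<bar>\<Sum>y | y \<in> {..<N div 2} \<and> r d y < t. \<eta> y\<bar> \<le> C * sqrt (2 * real N)"
      by blast
    have \<eta>: "\<bar>\<Sum>j | j < N div 2 \<and> R d (\<tau> (2 * j + e)) < t. \<eta> j\<bar> \<le> C * sqrt (2 * real N)"
      if "d < N" "e \<in> {0, 1}" for d e t
      using \<eta>_disc[rule_format, of "(d, e)" t] that by (simp add: r_def)
    \<comment> \<open>For odd N the last position has no partner; it gets the sign 1 and costs at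
      most 1.\<close>
    define \<psi> where "\<psi> z = (if z div 2 < N div 2 then if even z then \<eta> (z div 2) else - \<eta> (z div 2) else 1)" for z
    have \<psi>: "\<psi> z \<in> {-1, 1}" for z using \<eta>_sign by (auto simp: \<psi>_def)
    define f where "f x = \<psi> (\<sigma> x)" for x
    have flt: "(\<Sum>j | j < M \<and> P j. g j) = (\<Sum>j<M. if P j then g j else 0)" for M P and g :: "nat \<Rightarrow> real"
      by (subst sum.inter_filter[symmetric]) auto
    have tr: "(\<Sum>x | x < N \<and> P x. f x) = (\<Sum>z<N. if P (\<tau> z) then \<psi> z else 0)" for P
    proof -
      have "(\<Sum>x | x < N \<and> P x. f x) = (\<Sum>x<N. if P x then f x else 0)"
        by (rule flt)
      also have "\<dots> = (\<Sum>z<N. if P (\<tau> z) then f (\<tau> z) else 0)"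
        by (rule sum.reindex_bij_betw[OF \<tau>, symmetric])
      also have "\<dots> = (\<Sum>z<N. if P (\<tau> z) then \<psi> z else 0)"
        by (intro sum.cong) (auto simp: f_def \<sigma>\<tau>)
      finally show ?thesis .
    qed
    have pre: "\<bar>\<Sum>z<b. \<psi> z\<bar> \<le> 1" if "b \<le> N" for b
    proof -
      have "(\<Sum>j<b div 2. \<psi> (2 * j) + \<psi> (2 * j + 1)) = 0"
        using div_le_mono[OF that, of 2] by (intro sum.neutral) (auto simp: \<psi>_def)
      thus ?thesis using sum_lessThan_pairs[of \<psi> b] \<psi>[of "b - 1"] by auto
    qed
    show "\<exists>f :: nat \<Rightarrow> real. (\<forall>x<N. f x \<in> {-1, 1}) \<and>
         (\<forall>a b. a \<le> b \<longrightarrow> b \<le> N \<longrightarrow> \<bar>\<Sum>x | x < N \<and> \<sigma> x \<in> {a..<b}. f x\<bar> \<le> 2) \<and>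
         (\<forall>d<N. \<forall>t. \<bar>\<Sum>x | x < N \<and> R d x < t. f x\<bar> \<le> (2 * C * sqrt 2 + 1) * sqrt N)"
    proof (intro exI[of _ f] conjI allI impI)
      fix x show "f x \<in> {-1, 1}" using \<psi> by (simp add: f_def)
    next
      fix a b assume ab: "a \<le> b" "b \<le> N"
      have "(\<Sum>x | x < N \<and> \<sigma> x \<in> {a..<b}. f x) = (\<Sum>z<N. if \<sigma> (\<tau> z) \<in> {a..<b} then \<psi> z else 0)"
        by (rule tr)
      also have "\<dots> = (\<Sum>z<N. if z \<in> {a..<b} then \<psi> z else 0)"
        by (intro sum.cong) (auto simp: \<sigma>\<tau>)
      also have "\<dots> = (\<Sum>z\<in>{..<N} \<inter> {a..<b}. \<psi> z)"
        by (rule sum.inter_restrict[symmetric]) simp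
      also have "{..<N} \<inter> {a..<b} = {..<b} - {..<a}" using ab by auto
      also have "(\<Sum>z\<in>{..<b} - {..<a}. \<psi> z) = (\<Sum>z<b. \<psi> z) - (\<Sum>z<a. \<psi> z)"
        using ab by (intro sum_diff) auto
      finally show "\<bar>\<Sum>x | x < N \<and> \<sigma> x \<in> {a..<b}. f x\<bar> \<le> 2"
        using pre[of a] pre[of b] ab by linarith
    next
      fix d t assume d: "d < N"
      define h where "h z = (if R d (\<tau> z) < t then \<psi> z else 0)" for z
      have last: "\<bar>if odd N then h (N - 1) else 0\<bar> \<le> 1" using \<psi>[of "N - 1"] by (auto simp: h_def)
      have "(\<Sum>x | x < N \<and> R d x < t. f x) = (\<Sum>z<N. h z)"
        unfolding h_def by (rule tr)
      also have "\<dots> = (\<Sum>j<N div 2. h (2 * j)) + (\<Sum>j<N div 2. h (2 * j + 1)) + (if odd N then h (N - 1) else 0)"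
        by (simp add: sum_lessThan_pairs[of h N] sum.distrib)
      also have "(\<Sum>j<N div 2. h (2 * j)) = (\<Sum>j | j < N div 2 \<and> R d (\<tau> (2 * j + 0)) < t. \<eta> j)"
        unfolding flt by (intro sum.cong) (auto simp: h_def \<psi>_def)
      also have "(\<Sum>j<N div 2. h (2 * j + 1)) = - (\<Sum>j | j < N div 2 \<and> R d (\<tau> (2 * j + 1)) < t. \<eta> j)"
        unfolding flt sum_negf[symmetric] by (intro sum.cong) (auto simp: h_def \<psi>_def)
      finally have "\<bar>\<Sum>x | x < N \<and> R d x < t. f x\<bar> \<le> 2 * (C * sqrt (2 * real N)) + 1"
        using \<eta>[OF d insertI1, of t] \<eta>[OF d insertI2[OF singletonI], of t] last by linarith
      also have "\<dots> \<le> 2 * (C * sqrt (2 * real N)) + sqrt N" using N by simp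
      also have "\<dots> = (2 * C * sqrt 2 + 1) * sqrt N" by (simp add: real_sqrt_mult algebra_simps)
      finally show "\<bar>\<Sum>x | x < N \<and> R d x < t. f x\<bar> \<le> (2 * C * sqrt 2 + 1) * sqrt N" .
    qed
  qed
qed

section \<open>Digit reversal\<close>

text \<open>The van der Corput ordering: the lowest base-p digit becomes the leading one of m
  digits. Digits of x beyond the lowest m are ignored.\<close>

primrec digit_reversal :: "nat \<Rightarrow> nat \<Rightarrow> nat \<Rightarrow> nat" where
  "digit_reversal p 0 x = 0"
| "digit_reversal p (Suc m) x = (x mod p) * p ^ m + digit_reversal p m (x div p)"

lemma digit_reversal_less: "p > 0 \<Longrightarrow> digit_reversal p m x < p ^ m"
proof (induction m arbitrary: x)
  case (Suc m)
  have "(x mod p) * p ^ m + digit_reversal p m (x div p) < (x mod p) * p ^ m + p ^ m"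
    using Suc by simp
  also have "\<dots> = Suc (x mod p) * p ^ m" by simp
  also have "\<dots> \<le> p * p ^ m" using Suc.prems by (intro mult_right_mono) (auto simp: Suc_le_eq)
  finally show ?case by simp
qed simp

text \<open>The reason why cosets become intervals: the i leading digits of the reversal depend only
  on the residue of x modulo p^i.\<close>

lemma digit_reversal_div:
  assumes "p > 0" "i \<le> m"
  shows "digit_reversal p m x div p ^ (m - i) = digit_reversal p i (x mod p ^ i)"
  using assms(2)
proof (induction m arbitrary: i x)
  case (Suc m)
  show ?case
  proof (cases i)
    case 0 thus ?thesis using digit_reversal_less[OF assms(1), of "Suc m" x] by simp
  next
    case (Suc i')
    have pm: "p ^ m = p ^ i' * p ^ (m - i')" using Suc Suc.prems by (simp flip: power_add)
    have "digit_reversal p (Suc m) x div p ^ (Suc m - i) = (x mod p) * p ^ i' + digit_reversal p m (x div p) div p ^ (m - i')"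
      using assms(1) by (simp add: Suc pm flip: mult.assoc)
    also have "digit_reversal p m (x div p) div p ^ (m - i') = digit_reversal p i' (x div p mod p ^ i')"
      using Suc Suc.prems Suc.IH[of i'] by simp
    also have "x div p mod p ^ i' = x mod p ^ i div p"
      using assms(1) by (simp add: Suc mod_mult2_eq)
    also have "x mod p = x mod p ^ i mod p" by (simp add: Suc mod_mod_cancel)
    finally show ?thesis by (simp add: Suc)
  qed
qed simp

lemma inj_on_digit_reversal:
  assumes "p > 0"
  shows "inj_on (digit_reversal p m) {..<p ^ m}"
proof (induction m)
  case (Suc m)
  show ?case
  proof (rule inj_onI)
    fix x y assume xy: "x \<in> {..<p ^ Suc m}" "y \<in> {..<p ^ Suc m}" "digit_reversal p (Suc m) x = digit_reversal p (Suc m) y"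
    have "digit_reversal p (Suc m) x div p ^ m = x mod p" "digit_reversal p (Suc m) y div p ^ m = y mod p"
      "digit_reversal p (Suc m) x mod p ^ m = digit_reversal p m (x div p)"
      "digit_reversal p (Suc m) y mod p ^ m = digit_reversal p m (y div p)"
      using digit_reversal_less[OF assms, of m] assms by simp_all
    hence "x mod p = y mod p" "digit_reversal p m (x div p) = digit_reversal p m (y div p)" using xy by auto
    moreover from this(2) have "x div p = y div p"
      by (rule inj_onD[OF Suc]) (use xy in \<open>auto simp: mult.commute intro: less_mult_imp_div_less\<close>)
    ultimately show "x = y" by (metis div_mult_mod_eq)
  qed
qed (auto simp: inj_on_def)

lemma bij_betw_digit_reversal:
  assumes "p > 0"
  shows "bij_betw (digit_reversal p m) {..<p ^ m} {..<p ^ m}"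
proof (rule bij_betw_imageI)
  show inj: "inj_on (digit_reversal p m) {..<p ^ m}" by (rule inj_on_digit_reversal[OF assms])
  show "digit_reversal p m ` {..<p ^ m} = {..<p ^ m}"
    by (rule endo_inj_surj[OF _ _ inj]) (auto simp: digit_reversal_less[OF assms])
qed

lemma residue_class_eq_digit_reversal_interval:
  assumes p: "p > 0" and i: "i \<le> m" and c: "c < p ^ i"
  obtains b where "Suc b * p ^ (m - i) \<le> p ^ m"
    "{x. x < p ^ m \<and> x mod p ^ i = c} = {x. x < p ^ m \<and> digit_reversal p m x \<in> {b * p ^ (m - i)..<Suc b * p ^ (m - i)}}"
proof -
  define b where "b = digit_reversal p i c"
  have "b < p ^ i" unfolding b_def by (rule digit_reversal_less[OF p])
  hence "Suc b * p ^ (m - i) \<le> p ^ i * p ^ (m - i)" by (intro mult_right_mono) auto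
  hence le: "Suc b * p ^ (m - i) \<le> p ^ m" using i by (simp flip: power_add)
  have eq: "x mod p ^ i = c \<longleftrightarrow> digit_reversal p m x \<in> {b * p ^ (m - i)..<Suc b * p ^ (m - i)}" for x
  proof -
    have "digit_reversal p m x \<in> {b * p ^ (m - i)..<Suc b * p ^ (m - i)} \<longleftrightarrow> digit_reversal p m x div p ^ (m - i) = b"
      using p div_nat_eqI[of "p ^ (m - i)" b "digit_reversal p m x"] dividend_less_div_times[of "p ^ (m - i)" "digit_reversal p m x"]
      by (auto simp: ac_simps)
    also have "\<dots> \<longleftrightarrow> digit_reversal p i (x mod p ^ i) = digit_reversal p i c"
      using digit_reversal_div[OF p i] by (simp add: b_def)
    also have "\<dots> \<longleftrightarrow> x mod p ^ i = c"
      using inj_onD[OF inj_on_digit_reversal[OF p, of i], of "x mod p ^ i" c] p c by auto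
    finally show ?thesis by simp
  qed
  show ?thesis by (rule that[OF le]) (simp add: eq)
qed

section \<open>Arithmetic progressions modulo N\<close>

lemma ex_ap_term_eq:
  fixes N d x :: nat
  assumes "x < N"
  shows "\<exists>t < N div gcd N d. (x mod gcd N d + t * d) mod N = x"
proof (cases "d = 0")
  case False
  define g where "g = gcd N d"
  have N: "N > 0" using assms by simp
  have g: "g > 0" "g dvd N" "g dvd d" using N by (auto simp: g_def)
  define q where "q = N div g"
  have q: "q > 0" using N g by (auto simp: q_def dvd_imp_le div_greater_zero_iff)
  obtain u v where uv: "d * u = N * v + g"
    using bezout_nat[OF False, of N] by (auto simp: g_def gcd.commute)
  define y where "y = x div g"
  \<comment> \<open>By Bezout, u steps of size d advance by g modulo N, so u * (x div g) steps lead
    from x mod g to x. This number is then reduced modulo q, the order of d in Z_N.\<close>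
  define t0 where "t0 = u * y"
  have "x mod g + t0 * d = x mod g + (d * u) * y" by (simp add: t0_def)
  also have "\<dots> = (x mod g + g * y) + N * (v * y)" by (simp add: uv algebra_simps)
  also have "x mod g + g * y = x" by (simp add: y_def)
  finally have 1: "(x mod g + t0 * d) mod N = x" using assms by simp
  have qd: "q * d = N * (d div g)" using g by (auto simp: q_def elim!: dvdE)
  have "t0 * d = (t0 div q * q + t0 mod q) * d" by simp
  also have "\<dots> = (t0 div q) * (q * d) + (t0 mod q) * d" by (simp only: algebra_simps)
  also have "\<dots> = (t0 mod q) * d + N * ((t0 div q) * (d div g))" by (simp add: qd)
  finally have "x mod g + t0 * d = (x mod g + (t0 mod q) * d) + N * ((t0 div q) * (d div g))" by simp
  hence "(x mod g + (t0 mod q) * d) mod N = x" using 1 by (metis mod_mult_self2)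
  moreover have "t0 mod q < q" using q by simp
  ultimately show ?thesis unfolding g_def q_def by blast
qed (use assms in auto)

text \<open>The range is the order of d in Z_N, because N/g and d/g are coprime. It is also the
  length bound in \<open>APs\<close>, so sums over the set \<open>ap_Zn\<close> may be taken over
  indices.\<close>

lemma inj_on_ap:
  fixes N d c :: nat
  assumes "N > 0"
  shows "inj_on (\<lambda>i. (c + i * d) mod N) {..<N div gcd N d}"
proof -
  define g where "g = gcd N d"
  have g: "g > 0" "g dvd N" "g dvd d" using assms by (auto simp: g_def)
  have cop: "coprime (N div g) (d div g)" using assms unfolding g_def by (intro div_gcd_coprime) auto
  have *: "i = j" if ij: "i \<le> j" "j < N div g" "(c + j * d) mod N = (c + i * d) mod N" for i j
  proof -
    have "N dvd (c + j * d) - (c + i * d)" using ij by (subst mod_eq_dvd_iff_nat[symmetric]) auto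
    hence "N dvd (j - i) * d" by (simp add: diff_mult_distrib)
    hence "(N div g) * g dvd ((j - i) * (d div g)) * g" using g by (simp add: mult.assoc)
    hence "N div g dvd (j - i) * (d div g)" by (subst (asm) dvd_times_right_cancel_iff) (use g in auto)
    hence "N div g dvd j - i" using cop coprime_dvd_mult_left_iff by blast
    moreover have "j - i < N div g" using ij by simp
    ultimately have "j - i = 0" using nat_dvd_not_less by blast
    thus "i = j" using ij(1) by simp
  qed
  show ?thesis
  proof (rule inj_onI)
    fix i j assume a: "i \<in> {..<N div gcd N d}" "j \<in> {..<N div gcd N d}" "(c + i * d) mod N = (c + j * d) mod N"
    show "i = j"
    proof (cases "i \<le> j")
      case True thus ?thesis by (rule *) (use a in \<open>auto simp: g_def\<close>)
    next
      case False
      hence "j \<le> i" by simp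
      hence "j = i" by (rule *) (use a in \<open>auto simp: g_def\<close>)
      thus ?thesis by simp
    qed
  qed
qed

text \<open>The orderings of the residues mod N whose intervals contain all progressions of difference d:
  one coset of the subgroup generated by d after the other, each traversed in steps of d.\<close>

definition ap_rank :: "nat \<Rightarrow> nat \<Rightarrow> nat \<Rightarrow> nat" where
  "ap_rank N d x = (x mod gcd N d) * N + (LEAST t. (x mod gcd N d + t * d) mod N = x)"

lemma ap_term_mod_gcd:
  fixes N d c :: nat
  assumes "c < gcd N d"
  shows "(c + t * d) mod N mod gcd N d = c"
proof -
  have "c + t * d = c + gcd N d * (t * (d div gcd N d))" by simp
  hence "(c + t * d) mod gcd N d = c mod gcd N d" by (metis mod_mult_self2)
  moreover have "(c + t * d) mod N mod gcd N d = (c + t * d) mod gcd N d" by (simp add: mod_mod_cancel)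
  ultimately show ?thesis using assms by simp
qed

lemma ap_rank_ap_term:
  assumes "N > 0" "c < gcd N d" "t < N div gcd N d"
  shows "ap_rank N d ((c + t * d) mod N) = c * N + t"
proof -
  have "(LEAST s. (c + s * d) mod N = (c + t * d) mod N) = t"
  proof (rule Least_equality)
    fix s assume s: "(c + s * d) mod N = (c + t * d) mod N"
    show "t \<le> s"
    proof (rule ccontr)
      assume "\<not> t \<le> s"
      hence "s = t" using inj_onD[OF inj_on_ap[OF assms(1), of c d] s] assms(3) by simp
      with \<open>\<not> t \<le> s\<close> show False by simp
    qed
  qed simp
  thus ?thesis using ap_term_mod_gcd[OF assms(2), of t] by (simp add: ap_rank_def)
qed

lemma ap_rank_cases:
  assumes "x < N"
  obtains c t where "c < gcd N d" "t < N div gcd N d" "t < N" "c = x mod gcd N d"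
    "x = (c + t * d) mod N" "ap_rank N d x = c * N + t"
proof -
  have N: "N > 0" using assms by simp
  obtain t where t: "t < N div gcd N d" "(x mod gcd N d + t * d) mod N = x"
    using ex_ap_term_eq[OF assms] by blast
  have c: "x mod gcd N d < gcd N d" using N by simp
  have "t < N" using t(1) by (meson div_le_dividend less_le_trans)
  moreover have "ap_rank N d x = (x mod gcd N d) * N + t"
    using ap_rank_ap_term[OF N c t(1)] t(2) by simp
  ultimately show ?thesis using that[OF c t(1)] t(2) by auto
qed

lemma inj_on_ap_rank: "inj_on (ap_rank N d) {..<N}"
proof (rule inj_onI)
  fix x y assume "x \<in> {..<N}" "y \<in> {..<N}" and eq: "ap_rank N d x = ap_rank N d y"
  hence xy: "x < N" "y < N" by auto
  obtain c t where x: "t < N" "x = (c + t * d) mod N" "ap_rank N d x = c * N + t"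
    using ap_rank_cases[OF xy(1)] by metis
  obtain c' t' where y: "t' < N" "y = (c' + t' * d) mod N" "ap_rank N d y = c' * N + t'"
    using ap_rank_cases[OF xy(2)] by metis
  have "c * N + t = c' * N + t'" using eq x y by simp
  hence "(c * N + t) div N = (c' * N + t') div N" "(c * N + t) mod N = (c' * N + t') mod N" by simp_all
  hence "c = c'" "t = t'" using x(1) y(1) by simp_all
  thus "x = y" using x y by simp
qed

text \<open>Coset c uses ranks from c*N upwards, fewer than N of them. The spacing keeps cosets in
  separate blocks, so an incomplete lap from the representative c is a difference of two initial
  segments.\<close>

lemma ap_prefix_eq_rank_interval:
  assumes "N > 0" "c < gcd N d" "t \<le> N div gcd N d"
  shows "(\<lambda>i. (c + i * d) mod N) ` {..<t} = {x. x < N \<and> ap_rank N d x < c * N + t} - {x. x < N \<and> ap_rank N d x < c * N}"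
proof (intro equalityI subsetI)
  fix x assume "x \<in> (\<lambda>i. (c + i * d) mod N) ` {..<t}"
  then obtain i where i: "i < t" "x = (c + i * d) mod N" by auto
  hence "ap_rank N d x = c * N + i" using ap_rank_ap_term[OF assms(1,2), of i] assms(3) by simp
  thus "x \<in> {x. x < N \<and> ap_rank N d x < c * N + t} - {x. x < N \<and> ap_rank N d x < c * N}"
    using i assms(1) by simp
next
  fix x assume "x \<in> {x. x < N \<and> ap_rank N d x < c * N + t} - {x. x < N \<and> ap_rank N d x < c * N}"
  hence x: "x < N" "ap_rank N d x < c * N + t" "c * N \<le> ap_rank N d x" by auto
  obtain c' i where i: "i < N" "x = (c' + i * d) mod N" "ap_rank N d x = c' * N + i"
    using ap_rank_cases[OF x(1)] by metis
  have "t \<le> N" using assms(3) by (meson div_le_dividend le_trans)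
  hence "c * N \<le> c' * N + i" "c' * N + i < Suc c * N" using x i by auto
  hence "(c' * N + i) div N = c" using div_nat_eqI[of N c "c' * N + i"] by (simp add: ac_simps)
  hence "c' = c" using i(1) by simp
  thus "x \<in> (\<lambda>i. (c + i * d) mod N) ` {..<t}" using i x by auto
qed

lemma ap_full_eq_residue_class:
  fixes N d c :: nat
  assumes "N > 0" "c < gcd N d"
  shows "(\<lambda>i. (c + i * d) mod N) ` {..<N div gcd N d} = {x. x < N \<and> x mod gcd N d = c}"
proof (intro equalityI subsetI)
  fix x assume "x \<in> {x. x < N \<and> x mod gcd N d = c}"
  hence x: "x < N" "x mod gcd N d = c" by auto
  obtain t where "t < N div gcd N d" "(c + t * d) mod N = x" using ex_ap_term_eq[OF x(1), of d] x(2) by auto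
  thus "x \<in> (\<lambda>i. (c + i * d) mod N) ` {..<N div gcd N d}" by blast
next
  fix x assume "x \<in> (\<lambda>i. (c + i * d) mod N) ` {..<N div gcd N d}"
  then obtain t where "x = (c + t * d) mod N" by blast
  thus "x \<in> {x. x < N \<and> x mod gcd N d = c}" using ap_term_mod_gcd[OF assms(2), of t] assms(1) by simp
qed

lemma sum_periodic:
  fixes h :: "nat \<Rightarrow> real"
  assumes "\<And>i. h (i + q) = h i"
  shows "(\<Sum>i<t. h i) = real (t div q) * (\<Sum>i<q. h i) + (\<Sum>i<t mod q. h i)"
proof -
  have shift: "(\<Sum>i<n + q. h i) = (\<Sum>i<q. h i) + (\<Sum>i<n. h i)" for n
    by (induction n) (auto simp: assms)
  have "(\<Sum>i<a * q + b. h i) = real a * (\<Sum>i<q. h i) + (\<Sum>i<b. h i)" for a b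
  proof (induction a)
    case (Suc a)
    have "Suc a * q + b = (a * q + b) + q" by simp
    thus ?case using Suc shift[of "a * q + b"] by (simp add: algebra_simps)
  qed simp
  from this[of "t div q" "t mod q"] show ?thesis by simp
qed

text \<open>The progression is prolonged backwards by t0 < q steps to the representative c of its
  coset. Its sum is then a difference of two sums that start at c: one of less than a lap, the other
  of at most M laps and a remainder. Each of the two incomplete laps is a difference of two initial
  segments and costs 2B.\<close>

lemma abs_ap_sum_le:
  fixes f :: "nat \<Rightarrow> real"
  assumes N: "N > 0"
    and coset: "\<And>c. c < gcd N d \<Longrightarrow> \<bar>\<Sum>x | x < N \<and> x mod gcd N d = c. f x\<bar> \<le> A"
    and prefix: "\<And>t. \<bar>\<Sum>x | x < N \<and> ap_rank N d x < t. f x\<bar> \<le> B"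
    and l: "l \<le> M * (N div gcd N d)"
  shows "\<bar>\<Sum>i<l. f ((a + i * d) mod N)\<bar> \<le> real M * A + 4 * B"
proof -
  define q where "q = N div gcd N d"
  define c where "c = a mod N mod gcd N d"
  have c: "c < gcd N d" using N by (simp add: c_def)
  have q: "q > 0" using N by (auto simp: q_def dvd_imp_le div_greater_zero_iff)
  obtain t0 where t0: "t0 < q" "(c + t0 * d) mod N = a mod N"
    using ex_ap_term_eq[of "a mod N" N d] N unfolding c_def q_def by auto
  define h where "h i = f ((c + i * d) mod N)" for i
  have qd: "q * d = N * (d div gcd N d)"
    unfolding q_def by (metis dvd_div_mult div_mult_swap gcd_dvd1 gcd_dvd2)
  have per: "h (i + q) = h i" for i
  proof -
    have "c + (i + q) * d = (c + i * d) + N * (d div gcd N d)" by (simp add: distrib_right qd)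
    thus ?thesis unfolding h_def by (metis mod_mult_self2)
  qed
  have F: "\<bar>\<Sum>i<t. h i\<bar> \<le> 2 * B" if "t \<le> q" for t
  proof -
    have "inj_on (\<lambda>i. (c + i * d) mod N) {..<t}"
      using inj_on_subset[OF inj_on_ap[OF N]] that by (auto simp: q_def)
    hence "(\<Sum>i<t. h i) = (\<Sum>x\<in>(\<lambda>i. (c + i * d) mod N) ` {..<t}. f x)"
      by (simp add: sum.reindex h_def)
    also have "\<dots> = (\<Sum>x | x < N \<and> ap_rank N d x < c * N + t. f x) - (\<Sum>x | x < N \<and> ap_rank N d x < c * N. f x)"
      using that by (subst ap_prefix_eq_rank_interval[OF N c]) (auto simp: q_def intro!: sum_diff)
    finally show ?thesis using prefix[of "c * N + t"] prefix[of "c * N"] by linarith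
  qed
  have S: "\<bar>\<Sum>i<q. h i\<bar> \<le> A"
  proof -
    have "(\<Sum>i<q. h i) = (\<Sum>x\<in>(\<lambda>i. (c + i * d) mod N) ` {..<q}. f x)"
      using inj_on_ap[OF N, of c d] by (simp add: sum.reindex h_def q_def)
    thus ?thesis using coset[OF c] ap_full_eq_residue_class[OF N c] by (simp add: q_def)
  qed
  have G: "(\<Sum>i<t0 + l. h i) = (\<Sum>i<t0. h i) + (\<Sum>i<l. f ((a + i * d) mod N))"
  proof (induction l)
    case (Suc l)
    have "(c + (t0 + l) * d) mod N = ((c + t0 * d) mod N + l * d) mod N"
      by (simp only: mod_add_left_eq distrib_right add.assoc)
    also have "\<dots> = (a + l * d) mod N" by (simp add: t0(2) mod_add_left_eq)
    finally show ?case using Suc by (simp add: h_def)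
  qed simp
  have "\<bar>\<Sum>i<t0 + l. h i\<bar> \<le> real M * A + 2 * B"
  proof -
    have "t0 + l < Suc M * q" using t0(1) l by (simp add: q_def)
    hence "(t0 + l) div q < Suc M" using q by (simp add: div_less_iff_less_mult)
    hence "real ((t0 + l) div q) * \<bar>\<Sum>i<q. h i\<bar> \<le> real M * A"
      using S by (intro mult_mono) auto
    hence "\<bar>real ((t0 + l) div q) * (\<Sum>i<q. h i)\<bar> \<le> real M * A" by (simp add: abs_mult)
    moreover have "\<bar>\<Sum>i<(t0 + l) mod q. h i\<bar> \<le> 2 * B" using q by (intro F) (simp add: less_imp_le)
    ultimately show ?thesis using sum_periodic[of h q "t0 + l", OF per] by linarith
  qed
  thus ?thesis using G F[of t0] t0(1) by linarith
qed

section \<open>From bounds on single progressions to \<open>disc_AP\<close>\<close>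

lemma finite_APs [simp]: "n > 0 \<Longrightarrow> finite (APs n)"
  by (rule finite_subset[of _ "Pow {..<n}"]) (auto simp: APs_def ap_Zn_def)

lemma ap_Zn_in_APs:
  "\<lbrakk>a < n; d < n; l \<le> n div gcd n d\<rbrakk> \<Longrightarrow> ap_Zn n a d l \<in> APs n"
  unfolding APs_def by blast

lemma APs_nonempty: "n > 0 \<Longrightarrow> APs n \<noteq> {}"
  using ap_Zn_in_APs[of 0 n 0 0] by auto

lemma finite_colourings [simp]: "finite (colourings n)"
  by (auto simp: colourings_def intro!: finite_PiE)

lemma colourings_nonempty: "colourings n \<noteq> {}"
  by (auto simp: colourings_def PiE_eq_empty_iff)

lemma abs_sum_le_max_disc:
  "n > 0 \<Longrightarrow> A \<in> APs n \<Longrightarrow> \<bar>\<Sum>x\<in>A. f x\<bar> \<le> max_disc n f"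
  unfolding max_disc_def by (intro Max_ge) auto

lemma disc_AP_upperI:
  fixes B :: real
  assumes "n > 0" "f \<in> colourings n" "\<And>A. A \<in> APs n \<Longrightarrow> real_of_int \<bar>\<Sum>x\<in>A. f x\<bar> \<le> B"
  shows "real_of_int (disc_AP n) \<le> B"
proof -
  have "max_disc n f \<in> (\<lambda>A. \<bar>\<Sum>x\<in>A. f x\<bar>) ` APs n"
    unfolding max_disc_def using assms(1) APs_nonempty by (intro Max_in) auto
  hence "real_of_int (max_disc n f) \<le> B" using assms(3) by auto
  moreover have "disc_AP n \<le> max_disc n f" unfolding disc_AP_def using assms(2) by (intro Min_le) auto
  ultimately show ?thesis by linarith
qed

lemma disc_AP_lowerI:
  fixes B :: real
  assumes "\<And>f. f \<in> colourings n \<Longrightarrow> B \<le> real_of_int (max_disc n f)"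
  shows "B \<le> real_of_int (disc_AP n)"
proof -
  have "disc_AP n \<in> max_disc n ` colourings n"
    unfolding disc_AP_def using colourings_nonempty by (intro Min_in) auto
  thus ?thesis using assms by auto
qed

lemma sum_ap_Zn:
  assumes "n > 0" "l \<le> n div gcd n d"
  shows "(\<Sum>x\<in>ap_Zn n a d l. F x) = (\<Sum>i<l. F ((a + i * d) mod n))"
proof -
  have "ap_Zn n a d l = (\<lambda>i. (a + i * d) mod n) ` {..<l}" by (auto simp: ap_Zn_def)
  moreover have "inj_on (\<lambda>i. (a + i * d) mod n) {..<l}"
    using inj_on_subset[OF inj_on_ap[OF assms(1)]] assms(2) by auto
  ultimately show ?thesis by (simp add: sum.reindex)
qed

section \<open>Upper bound\<close>

lemma disc_AP_le:
  obtains c :: real where "c > 0"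
    "\<And>p k s. prime p \<Longrightarrow> 3 * s \<le> k \<Longrightarrow> real_of_int (disc_AP (p ^ k)) \<le> c * sqrt (real p ^ (k - s))"
proof -
  obtain C :: real where C: "C > 0" and bal:
    "\<And>N (\<sigma> :: nat \<Rightarrow> nat) (R :: nat \<Rightarrow> nat \<Rightarrow> nat).
       \<lbrakk>N > 0; bij_betw \<sigma> {..<N} {..<N}; \<And>d. d < N \<Longrightarrow> inj_on (R d) {..<N}\<rbrakk> \<Longrightarrow>
       \<exists>f :: nat \<Rightarrow> real. (\<forall>x<N. f x \<in> {-1, 1}) \<and>
         (\<forall>a b. a \<le> b \<longrightarrow> b \<le> N \<longrightarrow> \<bar>\<Sum>x | x < N \<and> \<sigma> x \<in> {a..<b}. f x\<bar> \<le> 2) \<and>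
         (\<forall>d<N. \<forall>t. \<bar>\<Sum>x | x < N \<and> R d x < t. f x\<bar> \<le> C * sqrt N)"
    using balanced_prefix_colouring by blast
  show ?thesis
  proof (rule that[of "2 + 4 * C"])
    show "2 + 4 * C > 0" using C by simp
    fix p k s :: nat assume p: "prime p" and ks: "3 * s \<le> k"
    define m where "m = k - s"
    define N where "N = p ^ m"
    define n where "n = p ^ k"
    have p0: "p > 0" using p prime_gt_0_nat by blast
    have pos: "N > 0" "n > 0" using p0 by (auto simp: N_def n_def)
    have nN: "n = p ^ s * N" using ks by (simp add: n_def N_def m_def flip: power_add)
    obtain f :: "nat \<Rightarrow> real" where f: "\<forall>x<N. f x \<in> {-1, 1}"
      and f_int: "\<forall>a b. a \<le> b \<longrightarrow> b \<le> N \<longrightarrow> \<bar>\<Sum>x | x < N \<and> digit_reversal p m x \<in> {a..<b}. f x\<bar> \<le> 2"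
      and f_pre: "\<forall>d<N. \<forall>t. \<bar>\<Sum>x | x < N \<and> ap_rank N d x < t. f x\<bar> \<le> C * sqrt N"
      using bal[of N "digit_reversal p m" "ap_rank N", OF pos(1)] bij_betw_digit_reversal[OF p0, of m] inj_on_ap_rank
      unfolding N_def by blast
    \<comment> \<open>The lift of \<open>f\<close> to Z_n with period N; the floor only passes from
      real to integer signs.\<close>
    define \<phi> where "\<phi> = restrict (\<lambda>x. \<lfloor>f (x mod N)\<rfloor>) {0..<n}"
    have fl: "real_of_int \<lfloor>f (x mod N)\<rfloor> = f (x mod N)" "\<lfloor>f (x mod N)\<rfloor> \<in> {1, -1}" for x
    proof -
      have "f (x mod N) = of_int (-1) \<or> f (x mod N) = of_int 1" using f pos by simp
      thus "real_of_int \<lfloor>f (x mod N)\<rfloor> = f (x mod N)" "\<lfloor>f (x mod N)\<rfloor> \<in> {1, -1}"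
        by (metis floor_of_int, metis floor_of_int insertCI)
    qed
    have "real_of_int (disc_AP n) \<le> (2 + 4 * C) * sqrt N"
    proof (rule disc_AP_upperI[OF pos(2)])
      show "\<phi> \<in> colourings n" unfolding \<phi>_def colourings_def using fl(2) by (intro restrict_PiE_iff[THEN iffD2]) auto
      fix A assume "A \<in> APs n"
      then obtain a d l where A: "A = ap_Zn n a d l" "a < n" "d < n" "l \<le> n div gcd n d"
        by (auto simp: APs_def)
      \<comment> \<open>The available orderings belong to differences below N. Reducing d changes
        neither the terms modulo N nor the gcd with N.\<close>
      define d' where "d' = d mod N"
      have d'N: "d' < N" using pos by (simp add: d'_def)
      have g: "gcd N d' = gcd N d" by (metis d'_def gcd.commute gcd_red_nat)
      have "real_of_int (\<Sum>x\<in>A. \<phi> x) = (\<Sum>i<l. f ((a + i * d') mod N))"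
      proof -
        have "real_of_int (\<Sum>x\<in>A. \<phi> x) = (\<Sum>i<l. real_of_int (\<phi> ((a + i * d) mod n)))"
          using sum_ap_Zn[OF pos(2) A(4), of \<phi> a] by (simp add: A)
        also have "\<dots> = (\<Sum>i<l. f ((a + i * d') mod N))"
        proof (intro sum.cong refl)
          fix i
          have "(a + i * d) mod n mod N = (a + i * d) mod N" by (simp add: nN mod_mod_cancel)
          also have "\<dots> = (a + i * d') mod N" unfolding d'_def by (metis mod_add_right_eq mod_mult_right_eq)
          finally have "(a + i * d) mod n mod N = (a + i * d') mod N" .
          thus "real_of_int (\<phi> ((a + i * d) mod n)) = f ((a + i * d') mod N)"
            using pos fl(1)[of "(a + i * d) mod n"] by (simp add: \<phi>_def)
        qed
        finally show ?thesis .
      qed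
      also have "\<bar>\<dots>\<bar> \<le> real (p ^ s) * 2 + 4 * (C * sqrt N)"
      proof (rule abs_ap_sum_le[OF pos(1)])
        fix c assume c: "c < gcd N d'"
        obtain i where i: "i \<le> m" "gcd N d' = p ^ i"
          using divides_primepow_nat[OF p, of "gcd N d'" m] by (auto simp: N_def)
        obtain b where b: "Suc b * p ^ (m - i) \<le> p ^ m"
          "{x. x < p ^ m \<and> x mod p ^ i = c} = {x. x < p ^ m \<and> digit_reversal p m x \<in> {b * p ^ (m - i)..<Suc b * p ^ (m - i)}}"
          by (rule residue_class_eq_digit_reversal_interval[OF p0 i(1) c[unfolded i(2)]])
        have "{x. x < N \<and> x mod gcd N d' = c} = {x. x < N \<and> digit_reversal p m x \<in> {b * p ^ (m - i)..<Suc b * p ^ (m - i)}}"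
          unfolding i(2) unfolding N_def by (rule b(2))
        thus "\<bar>\<Sum>x | x < N \<and> x mod gcd N d' = c. f x\<bar> \<le> 2"
          using f_int[rule_format, of "b * p ^ (m - i)" "Suc b * p ^ (m - i)"] b(1) by (simp add: N_def)
      next
        fix t show "\<bar>\<Sum>x | x < N \<and> ap_rank N d' x < t. f x\<bar> \<le> C * sqrt N" using f_pre d'N by blast
      next
        \<comment> \<open>Counting laps: at most n / gcd(n,d) terms, at N / gcd(N,d) terms per lap,
          make at most p^s laps.\<close>
        have "gcd N d dvd gcd n d" by (simp add: nN)
        hence "gcd N d \<le> gcd n d" using pos by (intro dvd_imp_le) auto
        hence "n div gcd n d \<le> n div gcd N d" using pos by (intro div_le_mono2) auto
        also have "\<dots> = p ^ s * (N div gcd N d)" by (simp add: nN div_mult_swap)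
        finally show "l \<le> p ^ s * (N div gcd N d')" using A(4) g by simp
      qed
      \<comment> \<open>Here 3s \<le> k enters, as 2s \<le> k - s.\<close>
      also have "real (p ^ s) \<le> sqrt N"
      proof (rule real_le_rsqrt)
        have "(p ^ s)\<^sup>2 \<le> N" unfolding N_def power_mult[symmetric] using p0 ks by (intro power_increasing) (auto simp: m_def)
        thus "(real (p ^ s))\<^sup>2 \<le> real N" by (metis of_nat_le_iff of_nat_power)
      qed
      finally show "real_of_int \<bar>\<Sum>x\<in>A. \<phi> x\<bar> \<le> (2 + 4 * C) * sqrt N" by (simp add: algebra_simps)
    qed
    thus "real_of_int (disc_AP (p ^ k)) \<le> (2 + 4 * C) * sqrt (real p ^ (k - s))"
      by (simp add: n_def N_def m_def)
  qed
qed

section \<open>Lower bound\<close>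

definition char_Zn :: "nat \<Rightarrow> int \<Rightarrow> complex" where
  "char_Zn n t = cis (2 * pi * of_int t / of_nat n)"

lemma char_Zn_add: "char_Zn n (s + t) = char_Zn n s * char_Zn n t"
  by (simp add: char_Zn_def cis_mult distrib_left add_divide_distrib)

lemma cnj_char_Zn: "cnj (char_Zn n t) = char_Zn n (- t)"
  by (simp add: char_Zn_def cis_cnj)

lemma char_Zn_eq_1_iff:
  assumes "n > 0"
  shows "char_Zn n t = 1 \<longleftrightarrow> int n dvd t"
proof
  assume "int n dvd t"
  then obtain k where "t = int n * k" by (rule dvdE)
  thus "char_Zn n t = 1" using assms cis_multiple_2pi[of "of_int k"] by (simp add: char_Zn_def mult.assoc)
next
  assume "char_Zn n t = 1"
  hence "cos (2 * pi * of_int t / of_nat n) = 1" by (simp add: char_Zn_def complex_eq_iff)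
  then obtain k :: int where "2 * pi * of_int t / of_nat n = of_int k * 2 * pi"
    unfolding cos_one_2pi_int by blast
  hence "real_of_int t = of_int (int n * k)" using assms by (simp add: field_simps)
  hence "t = int n * k" by (simp only: of_int_eq_iff)
  thus "int n dvd t" by simp
qed

lemma char_Zn_cong:
  assumes "n > 0" "int n dvd s - t"
  shows "char_Zn n s = char_Zn n t"
  using char_Zn_add[of n "s - t" t] char_Zn_eq_1_iff[of n "s - t"] assms by simp

lemma char_Zn_mult_power: "char_Zn n (int r * t) = char_Zn n t ^ r"
proof (induction r)
  case 0 show ?case by (simp add: char_Zn_def)
next
  case (Suc r) thus ?case by (simp add: distrib_right char_Zn_add)
qed

lemma sum_char_Zn:
  assumes "n > 0"
  shows "(\<Sum>r<n. char_Zn n (int r * t)) = (if int n dvd t then of_nat n else 0)"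
proof (cases "int n dvd t")
  case True
  thus ?thesis using char_Zn_eq_1_iff[OF assms, of t] by (simp add: char_Zn_mult_power)
next
  case False
  hence "char_Zn n t \<noteq> 1" using char_Zn_eq_1_iff[OF assms] by simp
  hence "(\<Sum>r<n. char_Zn n (int r * t)) = (char_Zn n t ^ n - 1) / (char_Zn n t - 1)"
    unfolding char_Zn_mult_power by (rule geometric_sum)
  moreover have "char_Zn n t ^ n = 1"
    using char_Zn_eq_1_iff[OF assms, of "int n * t"] by (simp add: char_Zn_mult_power)
  ultimately show ?thesis using False by simp
qed

text \<open>Expand the square and use orthogonality of characters. With \<open>u = int\<close> on
  the residues this yields Parseval's identity; with weights 1 it counts pairs with congruent values
  of \<open>u\<close>.\<close>

lemma sum_norm_exponential_sum:
  fixes c :: "'a \<Rightarrow> real" and u :: "'a \<Rightarrow> int"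
  assumes "n > 0" "finite X"
  shows "(\<Sum>r<n. (cmod (\<Sum>x\<in>X. of_real (c x) * char_Zn n (int r * u x)))\<^sup>2)
           = real n * (\<Sum>x\<in>X. \<Sum>y\<in>X. if int n dvd u x - u y then c x * c y else 0)"
proof -
  have "complex_of_real (\<Sum>r<n. (cmod (\<Sum>x\<in>X. of_real (c x) * char_Zn n (int r * u x)))\<^sup>2)
      = (\<Sum>r<n. (\<Sum>x\<in>X. of_real (c x) * char_Zn n (int r * u x)) * (\<Sum>y\<in>X. of_real (c y) * char_Zn n (- (int r * u y))))"
    by (simp only: of_real_sum complex_norm_square cnj_sum complex_cnj_mult complex_cnj_complex_of_real cnj_char_Zn)
  also have "\<dots> = (\<Sum>r<n. \<Sum>x\<in>X. \<Sum>y\<in>X. of_real (c x * c y) * char_Zn n (int r * (u x - u y)))"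
    by (simp add: sum_product right_diff_distrib mult_ac flip: char_Zn_add)
  also have "\<dots> = (\<Sum>x\<in>X. \<Sum>y\<in>X. \<Sum>r<n. of_real (c x * c y) * char_Zn n (int r * (u x - u y)))"
    by (subst sum.swap, intro sum.cong refl, rule sum.swap)
  also have "\<dots> = (\<Sum>x\<in>X. \<Sum>y\<in>X. of_real (c x * c y) * (if int n dvd u x - u y then of_nat n else 0))"
    by (simp only: sum_char_Zn[OF assms(1)] flip: sum_distrib_left)
  also have "\<dots> = complex_of_real (real n * (\<Sum>x\<in>X. \<Sum>y\<in>X. if int n dvd u x - u y then c x * c y else 0))"
    unfolding of_real_mult of_real_sum sum_distrib_left by (intro sum.cong refl) auto
  finally show ?thesis by (simp only: of_real_eq_iff)
qed

definition fourier_Zn :: "nat \<Rightarrow> (nat \<Rightarrow> real) \<Rightarrow> nat \<Rightarrow> complex" where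
  "fourier_Zn n f r = (\<Sum>x<n. of_real (f x) * char_Zn n (int r * int x))"

lemma parseval_Zn:
  assumes "n > 0"
  shows "(\<Sum>r<n. (cmod (fourier_Zn n f r))\<^sup>2) = real n * (\<Sum>x<n. (f x)\<^sup>2)"
proof -
  have "(\<Sum>r<n. (cmod (fourier_Zn n f r))\<^sup>2) = real n * (\<Sum>x<n. \<Sum>y<n. if int n dvd int x - int y then f x * f y else 0)"
    unfolding fourier_Zn_def using sum_norm_exponential_sum[OF assms, of "{..<n}" f int] by simp
  also have "(\<Sum>x<n. \<Sum>y<n. if int n dvd int x - int y then f x * f y else 0) = (\<Sum>x<n. (f x)\<^sup>2)"
  proof (intro sum.cong refl)
    fix x assume x: "x \<in> {..<n}"
    have "(\<Sum>y<n. if int n dvd int x - int y then f x * f y else 0) = (\<Sum>y<n. if x = y then f x * f y else 0)"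
    proof (intro sum.cong refl)
      fix y assume y: "y \<in> {..<n}"
      have "int n dvd int x - int y \<longleftrightarrow> int x mod int n = int y mod int n" by (simp add: mod_eq_dvd_iff)
      also have "\<dots> \<longleftrightarrow> x = y" using x y by simp
      finally show "(if int n dvd int x - int y then f x * f y else 0) = (if x = y then f x * f y else 0)" by simp
    qed
    thus "(\<Sum>y<n. if int n dvd int x - int y then f x * f y else 0) = (f x)\<^sup>2"
      using x by (simp add: power2_eq_square)
  qed
  finally show ?thesis .
qed

lemma bij_betw_add_mod: "n > 0 \<Longrightarrow> bij_betw (\<lambda>a. (a + b) mod n) {..<n} {..<n :: nat}"
proof (rule bij_betw_imageI)
  assume n: "n > 0"
  show inj: "inj_on (\<lambda>a. (a + b) mod n) {..<n}"
    using inj_on_ap[OF n, of b 1] by (simp add: add.commute)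
  show "(\<lambda>a. (a + b) mod n) ` {..<n} = {..<n}"
    by (rule endo_inj_surj[OF _ _ inj]) (use n in auto)
qed

text \<open>As a function of its start a, the progression sum is a correlation of f with the
  progression from 0. Its transform is \<open>fourier_Zn n f r\<close> times the conjugate of the
  exponential sum, and Parseval's identity finishes.\<close>

lemma sum_ap_squares:
  assumes n: "n > 0"
  shows "real n * (\<Sum>a<n. (\<Sum>i<l. f ((a + i * d) mod n))\<^sup>2)
     = (\<Sum>r<n. (cmod (fourier_Zn n f r))\<^sup>2 * (cmod (\<Sum>i<l. char_Zn n (int r * (int i * int d))))\<^sup>2)"
proof -
  define g where "g a = (\<Sum>i<l. f ((a + i * d) mod n))" for a
  define W where "W r = (\<Sum>i<l. char_Zn n (int r * (int i * int d)))" for r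
  have "fourier_Zn n g r = fourier_Zn n f r * cnj (W r)" for r
  proof -
    have "fourier_Zn n g r = (\<Sum>i<l. \<Sum>a<n. of_real (f ((a + i * d) mod n)) * char_Zn n (int r * int a))"
      unfolding fourier_Zn_def g_def of_real_sum sum_distrib_right by (rule sum.swap)
    also have "\<dots> = (\<Sum>i<l. fourier_Zn n f r * char_Zn n (- (int r * (int i * int d))))"
    proof (intro sum.cong refl)
      fix i
      have ch: "char_Zn n (int r * int a) = char_Zn n (int r * int ((a + i * d) mod n)) * char_Zn n (- (int r * (int i * int d)))" for a
      proof -
        have "int n dvd (int a + int i * int d) - (int a + int i * int d) mod int n" by (rule dvd_minus_mod)
        hence "int n dvd int r * ((int a + int i * int d) - (int a + int i * int d) mod int n)" by (rule dvd_mult)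
        hence "int n dvd int r * int a - (int r * int ((a + i * d) mod n) + - (int r * (int i * int d)))"
          by (simp add: zmod_int algebra_simps)
        thus ?thesis using char_Zn_cong[OF n] by (simp add: char_Zn_add[symmetric])
      qed
      have "(\<Sum>a<n. of_real (f ((a + i * d) mod n)) * char_Zn n (int r * int a))
          = (\<Sum>a<n. of_real (f ((a + i * d) mod n)) * char_Zn n (int r * int ((a + i * d) mod n))) * char_Zn n (- (int r * (int i * int d)))"
        unfolding sum_distrib_right by (intro sum.cong refl) (subst ch, simp only: mult.assoc)
      also have "(\<Sum>a<n. of_real (f ((a + i * d) mod n)) * char_Zn n (int r * int ((a + i * d) mod n))) = fourier_Zn n f r"
        unfolding fourier_Zn_def
        by (rule sum.reindex_bij_betw[OF bij_betw_add_mod[OF n], of "\<lambda>x. of_real (f x) * char_Zn n (int r * int x)"])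
      finally show "(\<Sum>a<n. of_real (f ((a + i * d) mod n)) * char_Zn n (int r * int a)) = fourier_Zn n f r * char_Zn n (- (int r * (int i * int d)))" .
    qed
    also have "\<dots> = fourier_Zn n f r * cnj (W r)"
      by (simp add: W_def cnj_char_Zn flip: sum_distrib_left)
    finally show ?thesis .
  qed
  hence "(\<Sum>r<n. (cmod (fourier_Zn n g r))\<^sup>2) = (\<Sum>r<n. (cmod (fourier_Zn n f r))\<^sup>2 * (cmod (W r))\<^sup>2)"
    by (simp add: norm_mult power_mult_distrib)
  thus ?thesis using parseval_Zn[OF n, of g] by (simp add: g_def W_def)
qed

text \<open>Summing over all differences replaces the size of single exponential sums by a count of
  collisions. It is used for the moduli p^k and p^(k-1), whose difference isolates the differences
  prime to p.\<close>

lemma sum_norm_interval_char: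
  assumes "n > 0"
  shows "(\<Sum>d<n. (cmod (\<Sum>i<l. char_Zn n (int d * (int r * int i))))\<^sup>2)
    = real n * real (card {(i, j). i < l \<and> j < l \<and> int n dvd int r * (int i - int j)})"
proof -
  have "(\<Sum>d<n. (cmod (\<Sum>i<l. char_Zn n (int d * (int r * int i))))\<^sup>2)
     = real n * (\<Sum>i<l. \<Sum>j<l. if int n dvd int r * (int i - int j) then 1 else 0)"
    using sum_norm_exponential_sum[OF assms, of "{..<l}" "\<lambda>_. 1" "\<lambda>i. int r * int i"]
    by (simp add: right_diff_distrib cong: if_cong)
  also have "(\<Sum>i<l. \<Sum>j<l. if int n dvd int r * (int i - int j) then 1 else 0 :: real)
     = (\<Sum>z\<in>{..<l} \<times> {..<l}. if int n dvd int r * (int (fst z) - int (snd z)) then 1 else 0)"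
    by (simp add: sum.cartesian_product split_def)
  also have "\<dots> = real (card {z \<in> {..<l} \<times> {..<l}. int n dvd int r * (int (fst z) - int (snd z))})"
    by (subst sum.inter_filter[symmetric]) auto
  also have "{z \<in> {..<l} \<times> {..<l}. int n dvd int r * (int (fst z) - int (snd z))} = {(i, j). i < l \<and> j < l \<and> int n dvd int r * (int i - int j)}"
    by auto
  finally show ?thesis .
qed

lemma card_congruent_pairs_le:
  assumes "M > 0"
  shows "card {(i, j). i < l \<and> j < l \<and> i mod M = j mod M} \<le> l * ((l - 1) div M + 1)"
proof -
  have "{(i, j). i < l \<and> j < l \<and> i mod M = j mod M} = (SIGMA i:{..<l}. {j. j < l \<and> i mod M = j mod M})" by auto
  also have "card \<dots> = (\<Sum>i<l. card {j. j < l \<and> i mod M = j mod M})" by (rule card_SigmaI) auto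
  also have "\<dots> \<le> (\<Sum>i<l. (l - 1) div M + 1)"
  proof (rule sum_mono)
    fix i
    have "inj_on (\<lambda>j. j div M) {j. j < l \<and> i mod M = j mod M}"
      by (rule inj_onI) (metis (mono_tags, lifting) div_mult_mod_eq mem_Collect_eq)
    moreover have "(\<lambda>j. j div M) ` {j. j < l \<and> i mod M = j mod M} \<subseteq> {..(l - 1) div M}"
      by (auto intro!: div_le_mono)
    ultimately show "card {j. j < l \<and> i mod M = j mod M} \<le> (l - 1) div M + 1"
      using card_inj_on_le[of "\<lambda>j. j div M" _ "{..(l - 1) div M}"] by simp
  qed
  finally show ?thesis by simp
qed

lemma prime_power_dvd_of_dvd_mult:
  fixes p x y :: int
  assumes "prime p" "p ^ (a + b) dvd x * y" "\<not> p ^ Suc a dvd x"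
  shows "p ^ b dvd y"
  using assms(2,3)
proof (induction a arbitrary: x)
  case 0
  hence "coprime (p ^ b) x" using assms(1) by (simp add: prime_imp_coprime)
  thus ?case using 0 by (simp add: coprime_dvd_mult_right_iff)
next
  case (Suc a)
  show ?case
  proof (cases "p dvd x")
    case True
    then obtain x' where x': "x = p * x'" by (rule dvdE)
    have p0: "p \<noteq> 0" using assms(1) by auto
    show ?thesis using Suc.prems p0 by (intro Suc.IH[of x']) (auto simp: x' mult.assoc)
  next
    case False
    hence "coprime (p ^ (Suc a + b)) x" using assms(1) by (simp add: prime_imp_coprime)
    hence "p ^ (Suc a + b) dvd y" using Suc.prems by (simp only: coprime_dvd_mult_right_iff)
    thus ?thesis by (metis dvd_trans le_add2 le_imp_power_dvd)
  qed
qed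

text \<open>Since l is at most half of p^(k-s), the progressions of length l with difference prime to p
  still see all frequencies of p-adic valuation exactly s.\<close>

lemma sum_unit_differences_ge:
  fixes p k s r :: nat
  assumes p: "prime p" and s: "s < k" and r: "\<not> p ^ Suc s dvd r"
  defines "n \<equiv> p ^ k" and "l \<equiv> p ^ (k - s) div 2"
  shows "(\<Sum>d | d < n \<and> \<not> p dvd d. (cmod (\<Sum>i<l. char_Zn n (int r * (int i * int d))))\<^sup>2) \<ge> real n * real l / 3"
proof -
  define h where "h d = (cmod (\<Sum>i<l. char_Zn n (int d * (int r * int i))))\<^sup>2" for d
  define n' where "n' = p ^ (k - 1)"
  define M where "M = p ^ (k - s - 1)"
  have p0: "p > 0" using p prime_gt_0_nat by blast
  have p2: "p \<ge> 2" using p prime_ge_2_nat by blast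
  have n: "n > 0" "n' > 0" "M > 0" using p0 by (auto simp: n_def n'_def M_def)
  have nn': "n = p * n'" using s by (simp add: n_def n'_def flip: power_Suc)
  have pM: "p ^ (k - s) = p * M" using s by (simp add: M_def Suc_diff_Suc flip: power_Suc)
  have "(\<Sum>d | d < n \<and> \<not> p dvd d. (cmod (\<Sum>i<l. char_Zn n (int r * (int i * int d))))\<^sup>2) = (\<Sum>d | d < n \<and> \<not> p dvd d. h d)"
    by (simp add: h_def mult_ac)
  \<comment> \<open>Differences prime to p are all differences minus the multiples of p, and the
    latter form a complete sum for the modulus n' = n/p.\<close>
  also have "\<dots> = (\<Sum>d\<in>{..<n} - (\<lambda>d. p * d) ` {..<n'}. h d)"
    by (rule sum.cong) (auto simp: nn' elim!: dvdE)
  also have "\<dots> = (\<Sum>d<n. h d) - (\<Sum>d\<in>(\<lambda>d. p * d) ` {..<n'}. h d)"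
    using p0 by (intro sum_diff) (auto simp: nn')
  also have "(\<Sum>d\<in>(\<lambda>d. p * d) ` {..<n'}. h d) = (\<Sum>d<n'. h (p * d))"
    using p0 by (subst sum.reindex) (auto simp: inj_on_def)
  also have "\<dots> = (\<Sum>d<n'. (cmod (\<Sum>i<l. char_Zn n' (int d * (int r * int i))))\<^sup>2)"
  proof -
    have "char_Zn n (int (p * d) * t) = char_Zn n' (int d * t)" for d t
      using p0 by (simp add: char_Zn_def nn' mult_ac)
    thus ?thesis by (simp add: h_def)
  qed
  also have "\<dots> = real n' * real (card {(i, j). i < l \<and> j < l \<and> int n' dvd int r * (int i - int j)})"
    by (rule sum_norm_interval_char[OF n(2)])
  also have "(\<Sum>d<n. h d) = real n * real (card {(i, j). i < l \<and> j < l \<and> int n dvd int r * (int i - int j)})"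
    unfolding h_def by (rule sum_norm_interval_char[OF n(1)])
  finally have eq: "(\<Sum>d | d < n \<and> \<not> p dvd d. (cmod (\<Sum>i<l. char_Zn n (int r * (int i * int d))))\<^sup>2)
     = real n * real (card {(i, j). i < l \<and> j < l \<and> int n dvd int r * (int i - int j)})
      - real n' * real (card {(i, j). i < l \<and> j < l \<and> int n' dvd int r * (int i - int j)})" .
  have fin: "finite {(i, j). i < l \<and> j < l \<and> Q i j}" for Q
    by (rule finite_subset[of _ "{..<l} \<times> {..<l}"]) auto
  \<comment> \<open>For the modulus n, the diagonal i = j alone gives a sufficient lower
    bound.\<close>
  have diag: "l \<le> card {(i, j). i < l \<and> j < l \<and> int n dvd int r * (int i - int j)}"
  proof -
    have "card ((\<lambda>i. (i, i)) ` {..<l}) \<le> card {(i, j). i < l \<and> j < l \<and> int n dvd int r * (int i - int j)}"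
      by (intro card_mono fin) auto
    thus ?thesis by (subst (asm) card_image) (auto simp: inj_on_def)
  qed
  \<comment> \<open>For the modulus n', a collision forces i and j to agree modulo M, and c bounds
    how many indices below l share a residue modulo M.\<close>
  define c where "c = (l - 1) div M + 1"
  have off: "card {(i, j). i < l \<and> j < l \<and> int n' dvd int r * (int i - int j)} \<le> l * c"
  proof -
    have "i mod M = j mod M" if "int n' dvd int r * (int i - int j)" for i j
    proof -
      have "int p ^ (s + (k - s - 1)) dvd int r * (int i - int j)" using that s by (simp add: n'_def)
      moreover have "\<not> int p ^ Suc s dvd int r" using r by (metis int_dvd_int_iff of_nat_power)
      moreover have "prime (int p)" using p by simp
      ultimately have "int p ^ (k - s - 1) dvd int i - int j" by (rule prime_power_dvd_of_dvd_mult[rotated])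
      hence "int i mod int M = int j mod int M" by (simp add: M_def mod_eq_dvd_iff)
      thus ?thesis by (metis of_nat_eq_iff zmod_int)
    qed
    hence "card {(i, j). i < l \<and> j < l \<and> int n' dvd int r * (int i - int j)} \<le> card {(i, j). i < l \<and> j < l \<and> i mod M = j mod M}"
      by (intro card_mono fin) auto
    also have "\<dots> \<le> l * c" unfolding c_def by (rule card_congruent_pairs_le[OF n(3)])
    finally show ?thesis .
  qed
  \<comment> \<open>From 2l \<le> p M follows c \<le> (p+1)/2, which is at most 2p/3 for p \<ge> 3;
    for p = 2 it means c = 1. With n' = n/p, at most two thirds of the main term n l are
    lost.\<close>
  have c: "3 * c \<le> 2 * p"
  proof -
    have "2 * 1 \<le> p * M" using p2 n(3) by (intro mult_le_mono) auto
    hence l: "2 * l \<le> p * M" "l \<ge> 1" unfolding l_def pM by auto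
    have "(c - 1) * M \<le> l - 1" by (simp add: c_def)
    hence "2 * (c - 1) * M < p * M" using l by linarith
    hence "2 * (c - 1) < p" by simp
    thus ?thesis using p2 by linarith
  qed
  have "real n' * real (card {(i, j). i < l \<and> j < l \<and> int n' dvd int r * (int i - int j)}) \<le> real n' * (real l * real c)"
    using off by (intro mult_left_mono) (simp_all flip: of_nat_mult)
  also have "\<dots> \<le> real n' * (real l * (2 * real p / 3))"
    using c by (intro mult_left_mono) auto
  also have "\<dots> = 2 / 3 * (real n * real l)" by (simp add: nn')
  finally have "real n' * real (card {(i, j). i < l \<and> j < l \<and> int n' dvd int r * (int i - int j)}) \<le> 2 / 3 * (real n * real l)" .
  moreover have "real n * real l \<le> real n * real (card {(i, j). i < l \<and> j < l \<and> int n dvd int r * (int i - int j)})"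
    using diag by (intro mult_left_mono) auto
  ultimately show ?thesis unfolding eq by linarith
qed

lemma max_disc_ge:
  fixes p k s :: nat
  assumes p: "prime p" and s: "s < k" "k \<le> 3 * s + 2" and f: "f \<in> colourings (p ^ k)"
  shows "sqrt (real p ^ (k - s)) / 4 \<le> real_of_int (max_disc (p ^ k) f)"
proof -
  define n where "n = p ^ k"
  define N where "N = p ^ (k - s)"
  define l where "l = N div 2"
  \<comment> \<open>\<open>M\<close> generates the subgroup of order \<open>q\<close> in Z_n; its
    cosets are the progressions of difference \<open>M\<close> and length \<open>q\<close>.\<close>
  define M where "M = p ^ (k - s - 1)"
  define q where "q = p ^ Suc s"
  define D where "D = real_of_int (max_disc n f)"
  define g where "g x = real_of_int (f x)" for x
  define E where "E r = (cmod (fourier_Zn n g r))\<^sup>2" for r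
  have p2: "p \<ge> 2" using p prime_ge_2_nat by blast
  have n: "n > 0" "M > 0" "q > 0" using p2 by (auto simp: n_def M_def q_def)
  have nMq: "n = M * q" using s by (simp add: n_def M_def q_def flip: power_add power_Suc)
  have Mn: "M < n" using p2 s unfolding M_def n_def by (intro power_strict_increasing) auto
  have "p ^ 1 \<le> N" unfolding N_def using p2 s by (intro power_increasing) auto
  hence N2: "N \<ge> 2" using p2 by simp
  \<comment> \<open>Rounding N/2 down keeps at least N/3 as soon as N \<ge> 2, with equality at N =
    3.\<close>
  have l: "l \<ge> 1" "3 * l \<ge> N" using N2 by (auto simp: l_def)
  have Nn: "N \<le> n" unfolding N_def n_def using p2 by (intro power_increasing) auto
  \<comment> \<open>Here k \<le> 3s + 2 enters, as k - s \<le> 2(s + 1).\<close>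
  have qN: "real N \<le> (real q)\<^sup>2"
  proof -
    have "N \<le> q ^ 2" unfolding N_def q_def power_mult[symmetric] using p2 s by (intro power_increasing) auto
    thus ?thesis by (metis of_nat_le_iff of_nat_power)
  qed
  have ap: "(\<Sum>i<m. g ((a + i * d) mod n))\<^sup>2 \<le> D\<^sup>2" if "a < n" "d < n" "m \<le> n div gcd n d" for a d m
  proof -
    have "\<bar>\<Sum>x\<in>ap_Zn n a d m. f x\<bar> \<le> max_disc n f"
      using that n by (intro abs_sum_le_max_disc ap_Zn_in_APs)
    hence "\<bar>\<Sum>i<m. f ((a + i * d) mod n)\<bar> \<le> max_disc n f"
      using that n by (simp add: sum_ap_Zn)
    hence "\<bar>\<Sum>i<m. g ((a + i * d) mod n)\<bar> \<le> D"
      unfolding g_def D_def by (simp only: of_int_le_iff flip: of_int_sum of_int_abs)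
    thus ?thesis by (metis abs_ge_zero power2_abs power_mono)
  qed
  have units: "l * (\<Sum>r | r < n \<and> \<not> q dvd r. E r) \<le> 3 * (real n)\<^sup>2 * D\<^sup>2"
  proof -
    have le: "(\<Sum>a<n. (\<Sum>i<l. g ((a + i * d) mod n))\<^sup>2) \<le> real n * D\<^sup>2" if d: "d < n" "\<not> p dvd d" for d
    proof -
      have "coprime p d" using d(2) p by (simp add: prime_imp_coprime)
      hence "gcd n d = 1" by (simp add: n_def)
      moreover have "l \<le> n" using Nn by (simp add: l_def)
      ultimately have "(\<Sum>i<l. g ((a + i * d) mod n))\<^sup>2 \<le> D\<^sup>2" if "a < n" for a
        using that d by (intro ap) auto
      hence "(\<Sum>a<n. (\<Sum>i<l. g ((a + i * d) mod n))\<^sup>2) \<le> (\<Sum>a<n. D\<^sup>2)" by (intro sum_mono) auto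
      thus ?thesis by simp
    qed
    define U where "U = {d. d < n \<and> \<not> p dvd d}"
    have finU: "finite U" by (simp add: U_def)
    have "card U \<le> card {..<n}" by (intro card_mono) (auto simp: U_def)
    hence cU: "card U \<le> n" by simp
    have "(\<Sum>r | r < n \<and> \<not> q dvd r. E r) * (real n * real l / 3)
        = (\<Sum>r | r < n \<and> \<not> q dvd r. E r * (real n * real l / 3))" by (rule sum_distrib_right)
    also have "\<dots> \<le> (\<Sum>r | r < n \<and> \<not> q dvd r. E r * (\<Sum>d\<in>U. (cmod (\<Sum>i<l. char_Zn n (int r * (int i * int d))))\<^sup>2))"
      unfolding U_def n_def l_def N_def E_def q_def
      using sum_unit_differences_ge[OF p s(1)] by (intro sum_mono mult_left_mono) auto
    \<comment> \<open>The added frequencies contribute nonnegative terms, and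
      \<open>sum_ap_squares\<close> needs all of them.\<close>
    also have "\<dots> \<le> (\<Sum>r<n. E r * (\<Sum>d\<in>U. (cmod (\<Sum>i<l. char_Zn n (int r * (int i * int d))))\<^sup>2))"
      by (intro sum_mono2) (auto simp: E_def intro!: mult_nonneg_nonneg sum_nonneg)
    also have "\<dots> = (\<Sum>d\<in>U. \<Sum>r<n. E r * (cmod (\<Sum>i<l. char_Zn n (int r * (int i * int d))))\<^sup>2)"
      unfolding sum_distrib_left by (rule sum.swap)
    also have "\<dots> = (\<Sum>d\<in>U. real n * (\<Sum>a<n. (\<Sum>i<l. g ((a + i * d) mod n))\<^sup>2))"
      unfolding E_def by (simp only: sum_ap_squares[OF n(1)])
    also have "\<dots> \<le> (\<Sum>d\<in>U. real n * (real n * D\<^sup>2))"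
      by (intro sum_mono mult_left_mono le) (auto simp: U_def)
    also have "\<dots> = real (card U) * (real n * (real n * D\<^sup>2))" by simp
    also have "\<dots> \<le> real n * (real n * (real n * D\<^sup>2))" using cU by (intro mult_right_mono) auto
    finally have "real n * (l * (\<Sum>r | r < n \<and> \<not> q dvd r. E r)) \<le> real n * (3 * (real n)\<^sup>2 * D\<^sup>2)"
      by (simp add: power2_eq_square field_simps)
    thus ?thesis using n(1) by simp
  qed
  have cosets: "(real q)\<^sup>2 * (\<Sum>r | r < n \<and> q dvd r. E r) \<le> (real n)\<^sup>2 * D\<^sup>2"
  proof -
    have "gcd n M = M" by (simp add: nMq)
    hence "q = n div gcd n M" using n by (simp add: nMq)
    hence le: "(\<Sum>i<q. g ((a + i * M) mod n))\<^sup>2 \<le> D\<^sup>2" if "a < n" for a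
      using that Mn by (intro ap) auto
    \<comment> \<open>At frequencies divisible by q the character is 1 on the whole subgroup, so its
      q terms do not cancel.\<close>
    have W: "(cmod (\<Sum>i<q. char_Zn n (int r * (int i * int M))))\<^sup>2 = (real q)\<^sup>2" if "q dvd r" for r
    proof -
      have "n dvd r * (i * M)" for i using that by (auto simp: nMq elim!: dvdE)
      hence "int n dvd int r * (int i * int M)" for i by (metis int_dvd_int_iff of_nat_mult)
      hence "char_Zn n (int r * (int i * int M)) = 1" for i using char_Zn_eq_1_iff[OF n(1)] by blast
      thus ?thesis by simp
    qed
    have "(real q)\<^sup>2 * (\<Sum>r | r < n \<and> q dvd r. E r)
        = (\<Sum>r | r < n \<and> q dvd r. E r * (cmod (\<Sum>i<q. char_Zn n (int r * (int i * int M))))\<^sup>2)"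
      unfolding sum_distrib_left by (intro sum.cong) (auto simp: W)
    also have "\<dots> \<le> (\<Sum>r<n. E r * (cmod (\<Sum>i<q. char_Zn n (int r * (int i * int M))))\<^sup>2)"
      by (intro sum_mono2) (auto simp: E_def)
    also have "\<dots> = real n * (\<Sum>a<n. (\<Sum>i<q. g ((a + i * M) mod n))\<^sup>2)"
      unfolding E_def by (rule sum_ap_squares[OF n(1), symmetric])
    also have "\<dots> \<le> real n * (\<Sum>a<n. D\<^sup>2)" using le by (intro mult_left_mono sum_mono) auto
    finally show ?thesis by (simp add: power2_eq_square mult_ac)
  qed
  have "(\<Sum>r<n. E r) = real n * (\<Sum>x<n. (g x)\<^sup>2)" unfolding E_def by (rule parseval_Zn[OF n(1)])
  also have "(\<Sum>x<n. (g x)\<^sup>2) = (\<Sum>x<n. 1)"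
  proof (intro sum.cong refl)
    fix x assume "x \<in> {..<n}"
    hence "f x \<in> {1, -1}" using f by (auto simp: colourings_def n_def PiE_def Pi_def)
    thus "(g x)\<^sup>2 = 1" by (auto simp: g_def)
  qed
  finally have tot: "(\<Sum>r<n. E r) = (real n)\<^sup>2" by (simp add: power2_eq_square)
  have split: "(\<Sum>r<n. E r) = (\<Sum>r | r < n \<and> \<not> q dvd r. E r) + (\<Sum>r | r < n \<and> q dvd r. E r)"
    by (subst sum.union_disjoint[symmetric]) (auto intro!: sum.cong)
  have E0: "(\<Sum>r | r < n \<and> \<not> q dvd r. E r) \<ge> 0" "(\<Sum>r | r < n \<and> q dvd r. E r) \<ge> 0"
    by (auto intro!: sum_nonneg simp: E_def)
  have "real N * (\<Sum>r | r < n \<and> \<not> q dvd r. E r) \<le> (3 * real l) * (\<Sum>r | r < n \<and> \<not> q dvd r. E r)"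
    using l(2) E0 by (intro mult_right_mono) linarith+
  hence 1: "real N * (\<Sum>r | r < n \<and> \<not> q dvd r. E r) \<le> 9 * ((real n)\<^sup>2 * D\<^sup>2)" using units by linarith
  have "real N * (\<Sum>r | r < n \<and> q dvd r. E r) \<le> (real q)\<^sup>2 * (\<Sum>r | r < n \<and> q dvd r. E r)"
    using qN E0 by (intro mult_right_mono)
  with cosets 1 have "real N * (\<Sum>r<n. E r) \<le> 10 * ((real n)\<^sup>2 * D\<^sup>2)"
    unfolding split distrib_left by linarith
  hence "(real n)\<^sup>2 * real N \<le> (real n)\<^sup>2 * (10 * D\<^sup>2)" unfolding tot by (simp add: mult_ac)
  hence "real N \<le> 10 * D\<^sup>2" using n(1) by simp
  \<comment> \<open>The differences prime to p contributed 9 and the cosets 1; 10 \<le> 16 gives the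
    constant 1/4.\<close>
  hence "real N \<le> (4 * D)\<^sup>2" by (simp add: power_mult_distrib)
  moreover have "D \<ge> 0"
  proof -
    have "0 \<le> \<bar>\<Sum>x\<in>ap_Zn n 0 0 0. f x\<bar>" by simp
    also have "\<dots> \<le> max_disc n f" using n by (intro abs_sum_le_max_disc ap_Zn_in_APs) auto
    finally show ?thesis by (simp add: D_def)
  qed
  ultimately have "sqrt (real N) \<le> 4 * D" by (intro real_le_lsqrt) auto
  thus ?thesis by (simp add: N_def D_def n_def)
qed

theorem theorem1p2:
  shows "\<exists>c1 c2 :: real. c1 > 0 \<and> c2 > 0 \<and>
    (\<forall>p k :: nat. prime p \<longrightarrow> k > 0 \<longrightarrow>
       c1 * real p powr ((real k - real (k div 3)) / 2) \<le> real_of_int (disc_AP (p ^ k)) \<and>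
       real_of_int (disc_AP (p ^ k)) \<le> c2 * real p powr ((real k - real (k div 3)) / 2))"
proof -
  obtain c :: real where c: "c > 0"
    and upper: "\<And>p k s. prime p \<Longrightarrow> 3 * s \<le> k \<Longrightarrow> real_of_int (disc_AP (p ^ k)) \<le> c * sqrt (real p ^ (k - s))"
    using disc_AP_le by blast
  have powr_eq: "real p powr ((real k - real (k div 3)) / 2) = sqrt (real p ^ (k - k div 3))" if "prime p" for p k :: nat
  proof -
    have p: "real p > 0" using that prime_gt_0_nat by simp
    have "real p powr ((real k - real (k div 3)) / 2) = (real p powr real (k - k div 3)) powr (1 / 2)"
      by (simp add: powr_powr)
    also have "\<dots> = sqrt (real p ^ (k - k div 3))" unfolding powr_realpow[OF p] using p by (simp add: powr_half_sqrt)
    finally show ?thesis .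
  qed
  show ?thesis
  proof (rule exI[of _ "1 / 4"], rule exI[of _ c], intro conjI allI impI c)
    fix p k :: nat assume p: "prime p" and k: "k > 0"
    show "1 / 4 * real p powr ((real k - real (k div 3)) / 2) \<le> real_of_int (disc_AP (p ^ k))"
    proof (rule disc_AP_lowerI)
      fix f assume "f \<in> colourings (p ^ k)"
      thus "1 / 4 * real p powr ((real k - real (k div 3)) / 2) \<le> real_of_int (max_disc (p ^ k) f)"
        using max_disc_ge[OF p, of "k div 3" k f] k by (simp add: powr_eq[OF p])
    qed
    show "real_of_int (disc_AP (p ^ k)) \<le> c * real p powr ((real k - real (k div 3)) / 2)"
      using upper[OF p, of "k div 3" k] by (simp add: powr_eq[OF p])
  qed simp
qed

end
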